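(* Let $M$ be a compact Riemannian manifold with induced metric $d$, let $\Psi=\{\Psi_t\}_{t\in\mathbb{R}}$ be a differentiable flow on $M$ and let $\nu$ be a probability measure on $M$ invariant for $\Psi$. Then for $\nu$-almost every $x\in M$ which is not a fixed point of $\Psi$, \[\underline{R}^{\Psi}(x)\leq \underline{d}_\nu(x)-1\qquad\text{and}\qquad\overline{R}^{\Psi}(x)\leq \overline{d}_\nu(x)-1.\]
   Context: A point $x$ is not a fixed point if there exists $t\in\mathbb{R}$ with $\Psi_t x\neq x$. For $x\in M$ and $r>0$, $B(x,r)$ is the ball of center $x$ and radius $r$, the first escape time is $\eta_r(x)=\inf\{t>0:\Psi_t x\notin B(x,r)\}$, and the return time is \[\tau_r^{\Psi}(x)=\inf\{t>\eta_r(x):\Psi_t(x)\in B(x,r)\}.\] The lower and upper recurrence rates are \[\underline{R}^{\Psi}(x)=\liminf_{r\to0}\frac{\log\tau_r^{\Psi}(x)}{-\log r},\qquad \overline{R}^{\Psi}(x)=\limsup_{r\to0}\frac{\log\tau_r^{\Psi}(x)}{-\log r}.\] The lower and upper pointwise dimensions of a Borel probability measure $\nu$ at $x$ are \[\underline{d}_\nu(x)=\liminf_{r\to0}\frac{\log\nu(B(x,r))}{\log r},\qquad \overline{d}_\nu(x)=\limsup_{r\to0}\frac{\log\nu(B(x,r))}{\log r}.\] *)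

theory Defs
  imports "HOL-Probability.Probability"
begin

section \<open>Smooth maps and smooth manifolds\<close>

text \<open>
  Class $C^k$ on an open set of a Euclidean space, stated with directional derivatives
  because the total derivative has a different codomain type at each order.
\<close>

fun Ck_on :: "nat \<Rightarrow> ('e::euclidean_space \<Rightarrow> 'f::real_normed_vector) \<Rightarrow> 'e set \<Rightarrow> bool" where
  "Ck_on 0 f S \<longleftrightarrow> continuous_on S f"
| "Ck_on (Suc k) f S \<longleftrightarrow>
     (\<forall>x\<in>S. f differentiable (at x)) \<and>
     (\<forall>v. Ck_on k (\<lambda>x. frechet_derivative f (at x) v) S)"

definition smooth_map_on :: "('e::euclidean_space \<Rightarrow> 'f::real_normed_vector) \<Rightarrow> 'e set \<Rightarrow> bool" where
  "smooth_map_on f S \<longleftrightarrow> (\<forall>k. Ck_on k f S)"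

text \<open>
  A manifold is a subset \<open>M\<close> of a Hausdorff space with its subspace topology, together with an
  atlas of pairs (domain, coordinate map); a coordinate map is irrelevant outside its domain.
  No second countability is required, since only compact \<open>M\<close> are considered below.
\<close>

type_synonym ('a, 'e) chart = "'a set \<times> ('a \<Rightarrow> 'e)"

abbreviation chart_dom :: "('a, 'e) chart \<Rightarrow> 'a set" where
  "chart_dom c \<equiv> fst c"

abbreviation chart_map :: "('a, 'e) chart \<Rightarrow> 'a \<Rightarrow> 'e" where
  "chart_map c \<equiv> snd c"

definition chart_inv :: "('a, 'e) chart \<Rightarrow> 'e \<Rightarrow> 'a" where
  "chart_inv c = inv_into (chart_dom c) (chart_map c)"

definition is_chart :: "'a::t2_space set \<Rightarrow> ('a, 'e::euclidean_space) chart \<Rightarrow> bool" where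
  "is_chart M c \<longleftrightarrow>
     openin (top_of_set M) (chart_dom c) \<and>
     open (chart_map c ` chart_dom c) \<and>
     homeomorphism (chart_dom c) (chart_map c ` chart_dom c) (chart_map c) (chart_inv c)"

definition transition :: "('a, 'e) chart \<Rightarrow> ('a, 'e) chart \<Rightarrow> 'e \<Rightarrow> 'e" where
  "transition c c' = chart_map c' \<circ> chart_inv c"

definition smooth_manifold ::
  "'a::t2_space set \<Rightarrow> ('a, 'e::euclidean_space) chart set \<Rightarrow> bool" where
  "smooth_manifold M A \<longleftrightarrow>
     (\<forall>c\<in>A. is_chart M c) \<and>
     (\<Union>c\<in>A. chart_dom c) = M \<and>
     (\<forall>c\<in>A. \<forall>c'\<in>A. smooth_map_on (transition c c') (chart_map c ` (chart_dom c \<inter> chart_dom c')))"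


section \<open>Riemannian metrics and the induced distance\<close>

text \<open>
  A Riemannian metric is given by its local expressions: \<open>g c p u v\<close> is the inner product at the
  point \<open>p\<close> of the tangent vectors whose coordinates in the chart \<open>c\<close> are \<open>u\<close> and \<open>v\<close>.
  The last clause says that the local expressions define the same inner product on each
  tangent space.
\<close>

type_synonym ('a, 'e) metric_tensor = "('a, 'e) chart \<Rightarrow> 'a \<Rightarrow> 'e \<Rightarrow> 'e \<Rightarrow> real"

definition riemannian_metric ::
  "('a::t2_space, 'e::euclidean_space) chart set \<Rightarrow> ('a, 'e) metric_tensor \<Rightarrow> bool" where
  "riemannian_metric A g \<longleftrightarrow>
     (\<forall>c\<in>A. \<forall>p\<in>chart_dom c.
        bilinear (g c p) \<and>
        (\<forall>u v. g c p u v = g c p v u) \<and>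
        (\<forall>u. u \<noteq> 0 \<longrightarrow> g c p u u > 0)) \<and>
     (\<forall>c\<in>A. \<forall>u v. smooth_map_on (\<lambda>y. g c (chart_inv c y) u v) (chart_map c ` chart_dom c)) \<and>
     (\<forall>c\<in>A. \<forall>c'\<in>A. \<forall>p\<in>chart_dom c \<inter> chart_dom c'. \<forall>u v.
        g c p u v =
        g c' p (frechet_derivative (transition c c') (at (chart_map c p)) u)
               (frechet_derivative (transition c c') (at (chart_map c p)) v))"

definition compact_riemannian_manifold ::
  "'a::t2_space set \<Rightarrow> ('a, 'e::euclidean_space) chart set \<Rightarrow> ('a, 'e) metric_tensor \<Rightarrow> bool" where
  "compact_riemannian_manifold M A g \<longleftrightarrow>
     compact M \<and> smooth_manifold M A \<and> riemannian_metric A g"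

definition C1_curve ::
  "('a::t2_space, 'e::euclidean_space) chart set \<Rightarrow> real \<Rightarrow> real \<Rightarrow> (real \<Rightarrow> 'a) \<Rightarrow> bool" where
  "C1_curve A a b \<gamma> \<longleftrightarrow>
     (\<forall>c\<in>A. \<exists>D.
        continuous_on {t\<in>{a..b}. \<gamma> t \<in> chart_dom c} D \<and>
        (\<forall>t\<in>{a..b}. \<gamma> t \<in> chart_dom c \<longrightarrow>
           ((\<lambda>s. chart_map c (\<gamma> s)) has_vector_derivative D t) (at t within {a..b})))"

text \<open>The set \<open>S\<close> contains the break points; on each closed piece the curve is $C^1$ up to the ends.\<close>

definition piecewise_C1_path ::
  "'a::t2_space set \<Rightarrow> ('a, 'e::euclidean_space) chart set \<Rightarrow> (real \<Rightarrow> 'a) \<Rightarrow> bool" where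
  "piecewise_C1_path M A \<gamma> \<longleftrightarrow>
     path \<gamma> \<and> path_image \<gamma> \<subseteq> M \<and>
     (\<exists>S. finite S \<and>
        (\<forall>a b. 0 \<le> a \<and> a < b \<and> b \<le> 1 \<and> {a<..<b} \<inter> S = {} \<longrightarrow> C1_curve A a b \<gamma>))"

definition curve_speed ::
  "('a::t2_space, 'e::euclidean_space) chart set \<Rightarrow> ('a, 'e) metric_tensor \<Rightarrow>
     (real \<Rightarrow> 'a) \<Rightarrow> real \<Rightarrow> real" where
  "curve_speed A g \<gamma> t =
     (let c = (SOME c. c \<in> A \<and> \<gamma> t \<in> chart_dom c);
          v = vector_derivative (\<lambda>s. chart_map c (\<gamma> s)) (at t within {0..1})
      in sqrt (g c (\<gamma> t) v v))"

definition curve_length ::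
  "('a::t2_space, 'e::euclidean_space) chart set \<Rightarrow> ('a, 'e) metric_tensor \<Rightarrow>
     (real \<Rightarrow> 'a) \<Rightarrow> real" where
  "curve_length A g \<gamma> = integral {0..1} (curve_speed A g \<gamma>)"

text \<open>
  The distance takes the value \<open>\<infinity>\<close> exactly between points in different components of \<open>M\<close>, so that
  \<open>M\<close> need not be assumed connected.
\<close>

definition riemannian_dist ::
  "'a::t2_space set \<Rightarrow> ('a, 'e::euclidean_space) chart set \<Rightarrow> ('a, 'e) metric_tensor \<Rightarrow>
     'a \<Rightarrow> 'a \<Rightarrow> ereal" where
  "riemannian_dist M A g x y =
     (INF \<gamma>\<in>{\<gamma>. piecewise_C1_path M A \<gamma> \<and> pathstart \<gamma> = x \<and> pathfinish \<gamma> = y}.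
        ereal (curve_length A g \<gamma>))"

definition dist_ball :: "'a set \<Rightarrow> ('a \<Rightarrow> 'a \<Rightarrow> ereal) \<Rightarrow> 'a \<Rightarrow> real \<Rightarrow> 'a set" where
  "dist_ball M d x r = {y\<in>M. d x y < ereal r}"


section \<open>Flows\<close>

text \<open>
  The map $(t,x) \mapsto \Psi_t x$ is differentiable as a map of manifolds
  $\mathbb{R} \times M \to M$, i.e. continuous with Frechet differentiable local expressions;
  continuity of the derivative is not required.
\<close>

definition differentiable_flow ::
  "'a::t2_space set \<Rightarrow> ('a, 'e::euclidean_space) chart set \<Rightarrow> (real \<Rightarrow> 'a \<Rightarrow> 'a) \<Rightarrow> bool" where
  "differentiable_flow M A \<Psi> \<longleftrightarrow>
     (\<forall>t. \<forall>x\<in>M. \<Psi> t x \<in> M) \<and>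
     (\<forall>x\<in>M. \<Psi> 0 x = x) \<and>
     (\<forall>s t. \<forall>x\<in>M. \<Psi> (s + t) x = \<Psi> s (\<Psi> t x)) \<and>
     continuous_on (UNIV \<times> M) (\<lambda>(t, x). \<Psi> t x) \<and>
     (\<forall>t. \<forall>c\<in>A. \<forall>c'\<in>A. \<forall>x\<in>chart_dom c. \<Psi> t x \<in> chart_dom c' \<longrightarrow>
        (\<lambda>(s, y). chart_map c' (\<Psi> s (chart_inv c y))) differentiable (at (t, chart_map c x)))"

definition borel_probability_on :: "'a::topological_space set \<Rightarrow> 'a measure \<Rightarrow> bool" where
  "borel_probability_on M \<nu> \<longleftrightarrow> prob_space \<nu> \<and> space \<nu> = M \<and> sets \<nu> = sets (restrict_space borel M)"

definition invariant_measure :: "(real \<Rightarrow> 'a \<Rightarrow> 'a) \<Rightarrow> 'a measure \<Rightarrow> bool" where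
  "invariant_measure \<Psi> \<nu> \<longleftrightarrow>
     (\<forall>t. \<forall>E\<in>sets \<nu>. emeasure \<nu> (\<Psi> t -` E \<inter> space \<nu>) = emeasure \<nu> E)"

definition fixed_point :: "(real \<Rightarrow> 'a \<Rightarrow> 'a) \<Rightarrow> 'a \<Rightarrow> bool" where
  "fixed_point \<Psi> x \<longleftrightarrow> (\<forall>t. \<Psi> t x = x)"


section \<open>Recurrence rates and pointwise dimensions\<close>

text \<open>Logarithm on $[0,\infty]$ with $\log 0 = -\infty$ and $\log \infty = \infty$.\<close>

definition log_ereal :: "ereal \<Rightarrow> ereal" where
  "log_ereal x =
     (if x \<le> 0 then -\<infinity> else if x = \<infinity> then \<infinity> else ereal (ln (real_of_ereal x)))"

text \<open>Times are infima in the extended reals, so the infimum of the empty set is \<open>\<infinity>\<close>.\<close>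

definition escape_time ::
  "'a set \<Rightarrow> ('a \<Rightarrow> 'a \<Rightarrow> ereal) \<Rightarrow> (real \<Rightarrow> 'a \<Rightarrow> 'a) \<Rightarrow> real \<Rightarrow> 'a \<Rightarrow> ereal" where
  "escape_time M d \<Psi> r x = Inf (ereal ` {t. t > 0 \<and> \<Psi> t x \<notin> dist_ball M d x r})"

definition return_time ::
  "'a set \<Rightarrow> ('a \<Rightarrow> 'a \<Rightarrow> ereal) \<Rightarrow> (real \<Rightarrow> 'a \<Rightarrow> 'a) \<Rightarrow> real \<Rightarrow> 'a \<Rightarrow> ereal" where
  "return_time M d \<Psi> r x =
     Inf (ereal ` {t. ereal t > escape_time M d \<Psi> r x \<and> \<Psi> t x \<in> dist_ball M d x r})"

definition lower_recurrence_rate ::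
  "'a set \<Rightarrow> ('a \<Rightarrow> 'a \<Rightarrow> ereal) \<Rightarrow> (real \<Rightarrow> 'a \<Rightarrow> 'a) \<Rightarrow> 'a \<Rightarrow> ereal" where
  "lower_recurrence_rate M d \<Psi> x =
     Liminf (at_right 0) (\<lambda>r. log_ereal (return_time M d \<Psi> r x) / ereal (- ln r))"

definition upper_recurrence_rate ::
  "'a set \<Rightarrow> ('a \<Rightarrow> 'a \<Rightarrow> ereal) \<Rightarrow> (real \<Rightarrow> 'a \<Rightarrow> 'a) \<Rightarrow> 'a \<Rightarrow> ereal" where
  "upper_recurrence_rate M d \<Psi> x =
     Limsup (at_right 0) (\<lambda>r. log_ereal (return_time M d \<Psi> r x) / ereal (- ln r))"

definition lower_pointwise_dim ::
  "'a set \<Rightarrow> ('a \<Rightarrow> 'a \<Rightarrow> ereal) \<Rightarrow> 'a measure \<Rightarrow> 'a \<Rightarrow> ereal" where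
  "lower_pointwise_dim M d \<nu> x =
     Liminf (at_right 0) (\<lambda>r. log_ereal (ereal (measure \<nu> (dist_ball M d x r))) / ereal (ln r))"

definition upper_pointwise_dim ::
  "'a set \<Rightarrow> ('a \<Rightarrow> 'a \<Rightarrow> ereal) \<Rightarrow> 'a measure \<Rightarrow> 'a \<Rightarrow> ereal" where
  "upper_pointwise_dim M d \<nu> x =
     Limsup (at_right 0) (\<lambda>r. log_ereal (ereal (measure \<nu> (dist_ball M d x r))) / ereal (ln r))"

end

theory Submission
  imports Defs
begin

text \<open>
  Cut a chart domain into cubes of side comparable to \<open>r\<close>, and let \<open>T\<close> be the time \<open>t\<close> map of
  the flow, with \<open>t\<close> comparable to \<open>r\<close>. By Poincare's argument, the points of a cube \<open>P\<close> that do
  not return to \<open>P\<close> during the first \<open>n\<close> iterations of \<open>T\<close> have measure at most \<open>1 / (n + 1)\<close>.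
  With \<open>n\<close> about \<open>r powr - \<epsilon> / \<nu> P\<close>, these points make up a fraction \<open>r powr \<epsilon>\<close> of \<open>P\<close>, and the
  cubes whose measure is less than \<open>r powr \<epsilon>\<close> times the measure of their neighbourhood have small
  total measure, because the neighbourhoods overlap boundedly often. The Borel-Cantelli lemma along
  \<open>r = 1 / 2 ^ k\<close> bounds almost all return times by \<open>n t\<close>, hence by about
  \<open>r powr (1 - \<epsilon>) / \<nu> (B x r)\<close>.
  The factor \<open>r\<close>, responsible for the \<open>- 1\<close>, comes from the time step: a non-fixed point has nonzero
  velocity, so it leaves its \<open>r\<close>-ball within a time comparable to \<open>r\<close>, and one iteration of \<open>T\<close>
  is already past the escape time.
\<close>

section \<open>Returns to the cells of a partition\<close>

text \<open>The preimages of the non-returning set under \<open>T ^^ k\<close>, for \<open>k\<close>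
  from 0 to \<open>n\<close>, are pairwise disjoint and have equal measure, and their union has
  measure at most 1.\<close>

lemma (in prob_space) prob_no_return_le:
  assumes T: "T \<in> measurable M M"
    and inv: "\<And>E. E \<in> events \<Longrightarrow> prob (T -` E \<inter> space M) = prob E"
    and B: "B \<in> events"
  shows "real (Suc n) * prob {y\<in>B. \<forall>k\<in>{1..n}. (T ^^ k) y \<notin> B} \<le> 1"
proof -
  define E where "E = {y\<in>B. \<forall>k\<in>{1..n}. (T ^^ k) y \<notin> B}"
  have Tk: "(T ^^ k) \<in> measurable M M" for k
    by (induction k) (use T in \<open>auto intro: measurable_comp\<close>)
  have "E = B - (\<Union>k\<in>{1..n}. (T ^^ k) -` B \<inter> space M)"
    using sets.sets_into_space[OF B] by (auto simp: E_def)
  also have "\<dots> \<in> events"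
    by (intro sets.Diff sets.finite_UN measurable_sets[OF Tk] B) auto
  finally have E: "E \<in> events" .
  define F where "F k = (T ^^ k) -` E \<inter> space M" for k
  have F: "F k \<in> events" for k
    using measurable_sets[OF Tk E] by (auto simp: F_def)
  have prob_F: "prob (F k) = prob E" for k
  proof (induction k)
    case 0
    then show ?case using sets.sets_into_space[OF E] by (auto simp: F_def Int_absorb2)
  next
    case (Suc k)
    have "F (Suc k) = T -` F k \<inter> space M"
      using measurable_space[OF T] by (auto simp: F_def funpow_swap1 simp del: funpow.simps(2)) (auto simp: funpow_swap1)
    then show ?case using inv[OF F] Suc by simp
  qed
  have "disjoint_family_on F {..n}"
  proof -
    \<comment> \<open>The \<open>j\<close>-th iterate of a common point lies in \<open>E\<close>,
      yet comes back to \<open>B\<close> after \<open>k - j\<close> further steps.\<close>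
    have "False" if "j < k" "k \<le> n" "z \<in> F j" "z \<in> F k" for j k z
    proof -
      have "(T ^^ (k - j)) ((T ^^ j) z) = (T ^^ k) z"
        using that(1) by (metis comp_apply funpow_add le_add_diff_inverse2 less_imp_le)
      moreover have "k - j \<in> {1..n}" using that by auto
      then have "(T ^^ (k - j)) ((T ^^ j) z) \<notin> B"
        using that(3) by (auto simp: F_def E_def simp del: atLeastAtMost_iff)
      ultimately show False
        using that(4) by (auto simp: F_def E_def)
    qed
    then show ?thesis
      unfolding disjoint_family_on_def by (metis atMost_iff disjoint_iff linorder_neqE_nat)
  qed
  then have "prob (\<Union>k\<in>{..n}. F k) = (\<Sum>k\<in>{..n}. prob (F k))"
    using F by (intro finite_measure_finite_Union) auto
  also have "\<dots> = real (Suc n) * prob E" by (simp add: prob_F)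
  finally show ?thesis using prob_le_1 E_def by metis
qed

text \<open>Think of \<open>P z\<close> as a cell and of \<open>N z\<close> as a neighbourhood of
  it. The discarded set consists of the cells that are light compared with their neighbourhood and
  of the slow points in the other cells. The light cells cost at most
  \<open>\<eta> * \<kappa>\<close> by bounded overlap, the slow points at most \<open>\<eta>\<close>
  by disjointness of the cells.\<close>

lemma (in prob_space) ex_small_no_return_set:
  fixes P N :: "'i \<Rightarrow> 'a set"
  assumes T: "T \<in> measurable M M"
    and inv: "\<And>E. E \<in> events \<Longrightarrow> prob (T -` E \<inter> space M) = prob E"
    and Z: "finite Z"
    and P: "\<And>z. z \<in> Z \<Longrightarrow> P z \<in> events" "disjoint_family_on P Z"
    and N: "\<And>z. z \<in> Z \<Longrightarrow> N z \<in> events" "\<And>y. y \<in> space M \<Longrightarrow> card {z\<in>Z. y \<in> N z} \<le> \<kappa>"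
    and \<eta>: "\<eta> > 0"
  shows "\<exists>D\<in>events. prob D \<le> \<eta> * (1 + real \<kappa>) \<and>
           (\<forall>z\<in>Z. \<forall>y\<in>P z - D. prob (P z) > \<eta> * prob (N z) \<and>
              (\<exists>n\<ge>1. (T ^^ n) y \<in> P z \<and> real n \<le> 1 / (\<eta> * prob (P z))))"
proof -
  \<comment> \<open>The floor serves both purposes: \<open>Suc (n z)\<close> is at least the
    quotient, which makes the slow part small, and \<open>n z\<close> is at most the quotient, which
    bounds the return. On a null cell the quotient is 0 by convention, but such a cell belongs to
    \<open>Zb\<close>.\<close>
  define n where "n z = nat \<lfloor>1 / (\<eta> * prob (P z))\<rfloor>" for z
  define E where "E z = {y\<in>P z. \<forall>k\<in>{1..n z}. (T ^^ k) y \<notin> P z}" for z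
  define Zb where "Zb = {z\<in>Z. prob (P z) \<le> \<eta> * prob (N z)}"
  define D where "D = (\<Union>z\<in>Zb. P z) \<union> (\<Union>z\<in>Z - Zb. E z)"
  have Tk: "(T ^^ k) \<in> measurable M M" for k
    by (induction k) (use T in \<open>auto intro: measurable_comp\<close>)
  have E: "E z \<in> events" if "z \<in> Z" for z
  proof -
    have "E z = P z - (\<Union>k\<in>{1..n z}. (T ^^ k) -` P z \<inter> space M)"
      using sets.sets_into_space[OF P(1)[OF that]] by (auto simp: E_def)
    also have "\<dots> \<in> events"
      by (intro sets.Diff sets.finite_UN measurable_sets[OF Tk] P(1)[OF that]) auto
    finally show ?thesis .
  qed
  have fin: "finite Zb" "finite (Z - Zb)" using Z by (auto simp: Zb_def)
  have E_le: "prob (E z) \<le> \<eta> * prob (P z)" if "z \<in> Z - Zb" for z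
  proof -
    have pos: "prob (P z) > 0"
      using that \<eta> by (auto simp: Zb_def not_le intro: le_less_trans[rotated])
    have "1 / (\<eta> * prob (P z)) \<le> real (Suc (n z))"
      unfolding n_def by linarith
    then have "1 \<le> \<eta> * prob (P z) * real (Suc (n z))"
      using pos \<eta> by (simp add: field_simps)
    moreover have "real (Suc (n z)) * prob (E z) \<le> 1"
      unfolding E_def using that by (intro prob_no_return_le T inv P) auto
    ultimately have "real (Suc (n z)) * prob (E z) \<le> real (Suc (n z)) * (\<eta> * prob (P z))"
      by (metis mult.commute order_trans)
    then show ?thesis by (metis mult_le_cancel_left_pos of_nat_0_less_iff zero_less_Suc)
  qed
  \<comment> \<open>The sum is the integral of the number of neighbourhoods containing a
    point.\<close>
  have sumN: "(\<Sum>z\<in>Z. prob (N z)) \<le> \<kappa>"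
  proof -
    have "(\<Sum>z\<in>Z. prob (N z)) = (\<Sum>z\<in>Z. (\<integral>y. indicator (N z) y \<partial>M))"
      using N(1) sets.sets_into_space by (intro sum.cong refl) (auto simp: Int_absorb2)
    also have "\<dots> = (\<integral>y. (\<Sum>z\<in>Z. indicator (N z) y) \<partial>M)"
      using N(1) by (subst Bochner_Integration.integral_sum) (auto simp: emeasure_eq_measure)
    also have "\<dots> \<le> (\<integral>y. real \<kappa> \<partial>M)"
    proof (rule integral_mono)
      show "integrable M (\<lambda>y. \<Sum>z\<in>Z. indicator (N z) y :: real)"
        using N(1) by (intro Bochner_Integration.integrable_sum) (auto simp: emeasure_eq_measure)
      fix y assume y: "y \<in> space M"
      have "(\<Sum>z\<in>Z. indicator (N z) y :: real) = real (card {z\<in>Z. y \<in> N z})"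
        using Z by (simp add: indicator_def sum.If_cases Int_def)
      then show "(\<Sum>z\<in>Z. indicator (N z) y) \<le> real \<kappa>" using N(2)[OF y] by simp
    qed auto
    also have "\<dots> = \<kappa>" by (simp add: prob_space)
    finally show ?thesis .
  qed
  have sumP: "(\<Sum>z\<in>Z. prob (P z)) \<le> 1"
    using finite_measure_finite_Union[OF Z _ P(2)] P(1) prob_le_1 by (metis image_subset_iff)
  have UN: "(\<Union>z\<in>Zb. P z) \<in> events" "(\<Union>z\<in>Z - Zb. E z) \<in> events"
    using fin E P(1) by (auto intro!: sets.finite_UN simp: Zb_def)
  then have D: "D \<in> events" unfolding D_def by auto
  have "prob D \<le> prob (\<Union>z\<in>Zb. P z) + prob (\<Union>z\<in>Z - Zb. E z)"
    unfolding D_def using UN by (intro measure_Un_le)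
  also have "\<dots> \<le> (\<Sum>z\<in>Zb. prob (P z)) + (\<Sum>z\<in>Z - Zb. prob (E z))"
    using fin E P(1) by (intro add_mono finite_measure_subadditive_finite) (auto simp: Zb_def)
  also have "\<dots> \<le> (\<Sum>z\<in>Zb. \<eta> * prob (N z)) + (\<Sum>z\<in>Z - Zb. \<eta> * prob (P z))"
    using E_le by (intro add_mono sum_mono) (auto simp: Zb_def)
  also have "\<dots> \<le> (\<Sum>z\<in>Z. \<eta> * prob (N z)) + (\<Sum>z\<in>Z. \<eta> * prob (P z))"
    using \<eta> Z by (intro add_mono sum_mono2) (auto simp: Zb_def)
  also have "\<dots> \<le> \<eta> * (1 + real \<kappa>)"
    using sumN sumP \<eta> by (simp add: sum_distrib_left[symmetric] distrib_left[symmetric])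
  finally have "prob D \<le> \<eta> * (1 + real \<kappa>)" .
  moreover have "prob (P z) > \<eta> * prob (N z) \<and>
      (\<exists>n\<ge>1. (T ^^ n) y \<in> P z \<and> real n \<le> 1 / (\<eta> * prob (P z)))"
    if z: "z \<in> Z" and y: "y \<in> P z - D" for z y
  proof -
    have zb: "z \<notin> Zb" using y by (auto simp: D_def)
    then have "y \<notin> E z" using y z by (auto simp: D_def)
    then obtain k where k: "k \<in> {1..n z}" "(T ^^ k) y \<in> P z"
      using y by (auto simp: E_def)
    have "real k \<le> 1 / (\<eta> * prob (P z))"
      using k(1) \<eta> by (auto simp: n_def le_nat_iff le_floor_iff)
    then show ?thesis using zb z k by (auto simp: Zb_def not_le)
  qed
  ultimately show ?thesis using D by blast
qed

section \<open>Rates from eventual bounds\<close>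

lemma log_ereal_mono:
  assumes "x \<le> y"
  shows "log_ereal x \<le> log_ereal y"
proof (cases "x \<le> 0 \<or> y = \<infinity>")
  case False
  with assms obtain a b where "x = ereal a" "y = ereal b"
    by (cases x; cases y) auto
  then show ?thesis using False assms by (auto simp: log_ereal_def)
qed (auto simp: log_ereal_def)

text \<open>After taking logarithms and dividing by \<open>- ln r\<close>, the factor
  \<open>r powr (1 - \<epsilon>)\<close> becomes the summand \<open>\<epsilon> - 1\<close>.\<close>

lemma log_ratio_le:
  assumes r: "0 < r" "r < 1" and \<mu>: "\<mu> \<ge> 0"
    and \<tau>: "\<mu> > 0 \<longrightarrow> \<tau> \<le> ereal (r powr (1 - \<epsilon>) / \<mu>)"
  shows "log_ereal \<tau> / ereal (- ln r) \<le> log_ereal (ereal \<mu>) / ereal (ln r) + ereal (\<epsilon> - 1)"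
proof (cases "\<mu> = 0")
  case True
  \<comment> \<open>The logarithm is minus infinity and \<open>ln r\<close> is negative, so the
    bound is trivial; this is why \<open>\<tau>\<close> is constrained only for positive
    \<open>\<mu>\<close>.\<close>
  have "log_ereal (ereal \<mu>) / ereal (ln r) = \<infinity>"
    using True r by (simp add: log_ereal_def divide_ereal_def)
  then show ?thesis by simp
next
  case False
  with \<mu> have pos: "\<mu> > 0" by simp
  have "log_ereal \<tau> \<le> log_ereal (ereal (r powr (1 - \<epsilon>) / \<mu>))"
    using \<tau> pos by (intro log_ereal_mono) simp
  also have "\<dots> = ereal ((1 - \<epsilon>) * ln r - ln \<mu>)"
    using pos r by (simp add: log_ereal_def ln_div ln_powr divide_le_0_iff)
  finally have "log_ereal \<tau> / ereal (- ln r) \<le> ereal ((1 - \<epsilon>) * ln r - ln \<mu>) / ereal (- ln r)"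
  proof (rule ereal_divide_right_mono)
    have "0 < - ln r" using r by simp
    then show "0 < ereal (- ln r)" by (simp only: zero_ereal_def less_ereal.simps)
  qed
  also have "\<dots> = ereal (((1 - \<epsilon>) * ln r - ln \<mu>) / (- ln r))"
    using r by simp
  also have "((1 - \<epsilon>) * ln r - ln \<mu>) / (- ln r) = ln \<mu> / ln r + (\<epsilon> - 1)"
  proof -
    have "ln r \<noteq> 0" using r by simp
    then show ?thesis by (simp add: field_simps)
  qed
  also have "ereal (ln \<mu> / ln r + (\<epsilon> - 1)) = log_ereal (ereal \<mu>) / ereal (ln r) + ereal (\<epsilon> - 1)"
    using pos r by (simp add: log_ereal_def)
  finally show ?thesis .
qed

lemma le_minus_one_ereal:
  fixes a b :: ereal
  assumes "\<And>n. a \<le> b + ereal (1 / real (Suc n) - 1)"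
  shows "a \<le> b - 1"
proof (rule ereal_le_epsilon2)
  fix e :: real assume "0 < e"
    then obtain n where n: "1 / real (Suc n) < e"
      using nat_approx_posE by blast
    have "a \<le> b + ereal (1 / real (Suc n) - 1)" by (rule assms)
    also have "\<dots> \<le> b - 1 + ereal e"
      using n by (cases b) (auto simp: one_ereal_def)
    finally show "a \<le> b - 1 + ereal e" .
qed

text \<open>The quotients are compared at every small \<open>r\<close>, not only along a sequence of
  scales, so one bound passes to the lower and to the upper limit; then the loss
  \<open>1 / real (Suc n)\<close> tends to 0.\<close>

lemma recurrence_rate_le_pointwise_dim:
  assumes "\<And>n. \<forall>\<^sub>F r in at_right 0. measure \<nu> (dist_ball M d x r) > 0 \<longrightarrow>
    return_time M d \<Psi> r x \<le> ereal (r powr (1 - 1 / real (Suc n)) / measure \<nu> (dist_ball M d x r))"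
  shows "lower_recurrence_rate M d \<Psi> x \<le> lower_pointwise_dim M d \<nu> x - 1"
    and "upper_recurrence_rate M d \<Psi> x \<le> upper_pointwise_dim M d \<nu> x - 1"
proof -
  let ?R = "\<lambda>r. log_ereal (return_time M d \<Psi> r x) / ereal (- ln r)"
  let ?D = "\<lambda>r. log_ereal (ereal (measure \<nu> (dist_ball M d x r))) / ereal (ln r)"
  have ev: "\<forall>\<^sub>F r in at_right 0. ?R r \<le> ?D r + ereal (1 / real (Suc n) - 1)" for n
  proof -
    have "\<forall>\<^sub>F r in at_right (0::real). 0 < r \<and> r < 1"
      by (auto simp: eventually_at_right_field intro: exI[of _ 1])
    with assms[of n] show ?thesis
      by eventually_elim (intro log_ratio_le, auto)
  qed
  have "Liminf (at_right 0) ?R \<le> Liminf (at_right 0) ?D + ereal (1 / real (Suc n) - 1)" for n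
    using Liminf_mono[OF ev[of n]] by (simp add: Liminf_add_ereal_right)
  then show "lower_recurrence_rate M d \<Psi> x \<le> lower_pointwise_dim M d \<nu> x - 1"
    unfolding lower_recurrence_rate_def lower_pointwise_dim_def by (rule le_minus_one_ereal)
  have "Limsup (at_right 0) ?R \<le> Limsup (at_right 0) ?D + ereal (1 / real (Suc n) - 1)" for n
    using Limsup_mono[OF ev[of n]] by (simp add: Limsup_add_ereal_right)
  then show "upper_recurrence_rate M d \<Psi> x \<le> upper_pointwise_dim M d \<nu> x - 1"
    unfolding upper_recurrence_rate_def upper_pointwise_dim_def by (rule le_minus_one_ereal)
qed

section \<open>Return times of a flow in a chart\<close>

text \<open>Separates the measure-theoretic argument from the geometry: near \<open>V\<close> the
  distance is comparable with the norm in coordinates, and no metric axiom for \<open>d\<close>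
  enters. The larger set \<open>U\<close> is there because a small ball centred in \<open>V\<close>
  may stick out of \<open>V\<close>.\<close>

locale flow_in_chart = prob_space \<nu> for \<nu> :: "'a measure" +
  fixes d :: "'a \<Rightarrow> 'a \<Rightarrow> ereal" and \<Psi> :: "real \<Rightarrow> 'a \<Rightarrow> 'a"
    and U V :: "'a set" and \<phi> :: "'a \<Rightarrow> 'e::euclidean_space" and C L \<delta> :: real
  assumes flow_measurable: "\<And>t. \<Psi> t \<in> measurable \<nu> \<nu>"
    and flow_invariant: "\<And>t E. E \<in> events \<Longrightarrow> prob (\<Psi> t -` E \<inter> space \<nu>) = prob E"
    and flow_zero: "\<And>x. x \<in> space \<nu> \<Longrightarrow> \<Psi> 0 x = x"
    and flow_add: "\<And>s t x. x \<in> space \<nu> \<Longrightarrow> \<Psi> (s + t) x = \<Psi> s (\<Psi> t x)"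
    and U: "U \<in> events" and V: "V \<in> events" "V \<subseteq> U"
    and coord_measurable: "\<phi> \<in> borel_measurable (restrict_space \<nu> U)"
    and coord_bounded: "bounded (\<phi> ` V)"
    and dist_le: "\<And>x y. x \<in> V \<Longrightarrow> y \<in> V \<Longrightarrow> d x y \<le> ereal (C * norm (\<phi> y - \<phi> x))"
    and coord_less: "\<And>x y r. x \<in> V \<Longrightarrow> y \<in> space \<nu> \<Longrightarrow> d x y < ereal r \<Longrightarrow> r \<le> \<delta> \<Longrightarrow>
                       y \<in> U \<and> norm (\<phi> y - \<phi> x) < L * r"
    and pos: "C > 0" "L > 0" "\<delta> > 0"
begin

text \<open>Expressed in coordinates rather than through \<open>d\<close>, so that the set is clearly measurable.\<close>

definition escaping :: "nat \<Rightarrow> 'a set" where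
  "escaping m = {x\<in>V. \<forall>k\<ge>m. \<Psi> (m / 2 ^ k) x \<in> U \<longrightarrow> norm (\<phi> (\<Psi> (m / 2 ^ k) x) - \<phi> x) \<ge> L / 2 ^ k}"

lemma V_space: "x \<in> V \<Longrightarrow> x \<in> space \<nu>"
  using V(1) sets.sets_into_space by blast

lemma coord_measurable': "(\<lambda>x. if x \<in> U then \<phi> x else 0) \<in> borel_measurable \<nu>"
  using coord_measurable U by (subst (asm) measurable_restrict_space_iff[where c = 0]) auto

lemma escaping_events: "escaping m \<in> events"
proof -
  let ?f = "\<lambda>x. if x \<in> U then \<phi> x else 0"
  \<comment> \<open>The points violating the condition of \<open>escaping m\<close> at scale
    \<open>k\<close>. Extending the coordinate map by 0 outside \<open>U\<close> makes the condition
    measurable on the whole space.\<close>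
  define W where "W k = {x\<in>space \<nu>. \<Psi> (m / 2 ^ k) x \<in> U \<and>
      norm (?f (\<Psi> (m / 2 ^ k) x) - ?f x) < L / 2 ^ k}" for k
  have [measurable]: "?f \<in> borel_measurable \<nu>" "\<Psi> t \<in> measurable \<nu> \<nu>" "U \<in> events" for t
    by (rule coord_measurable' flow_measurable U)+
  have W: "W k \<in> events" for k
    unfolding W_def by measurable
  have "escaping m = V - (\<Union>k\<in>{m..}. W k)"
    using V V_space by (auto simp: escaping_def W_def not_less)
  also have "\<dots> \<in> events"
    using V(1) W by (intro sets.Diff sets.countable_UN') auto
  finally show ?thesis .
qed

text \<open>Points of the ball of radius \<open>1 / 2 ^ k\<close>, which contains that of radius
  \<open>r\<close>, have coordinates within \<open>L / 2 ^ k\<close> of those of \<open>x\<close>,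
  and a point of \<open>escaping m\<close> is not that close at time \<open>m / 2 ^ k\<close>. The
  bound is thus uniform in \<open>r\<close>.\<close>

lemma escape_time_le:
  assumes x: "x \<in> escaping m" and m: "m \<ge> 1" and k: "k \<ge> m" "1 / 2 ^ k \<le> \<delta>" and r: "r \<le> 1 / 2 ^ k"
  shows "escape_time (space \<nu>) d \<Psi> r x \<le> ereal (m / 2 ^ k)"
proof -
  let ?t = "real m / 2 ^ k"
  have "\<Psi> ?t x \<notin> dist_ball (space \<nu>) d x r"
  proof
    assume "\<Psi> ?t x \<in> dist_ball (space \<nu>) d x r"
    then have "\<Psi> ?t x \<in> space \<nu>" "d x (\<Psi> ?t x) < ereal (1 / 2 ^ k)"
      using r by (auto simp: dist_ball_def intro: less_le_trans)
    then have "\<Psi> ?t x \<in> U \<and> norm (\<phi> (\<Psi> ?t x) - \<phi> x) < L * (1 / 2 ^ k)"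
      using x k(2) by (intro coord_less) (auto simp: escaping_def)
    then show False using x k(1) by (auto simp: escaping_def not_less[symmetric])
  qed
  moreover have "?t > 0" using m by simp
  ultimately show ?thesis
    unfolding escape_time_def by (intro Inf_lower) auto
qed

lemma flow_funpow: "x \<in> space \<nu> \<Longrightarrow> (\<Psi> t ^^ n) x = \<Psi> (real n * t) x"
proof (induction n)
  case 0
  then show ?case by (simp add: flow_zero)
next
  case (Suc n)
  then show ?case by (simp add: flow_add[symmetric] distrib_right)
qed

text \<open>
  The return time is not monotone in \<open>r\<close>, so a bound at \<open>r = 1 / 2 ^ k\<close> does not give one
  between consecutive scales. Instead one return serves all these \<open>r\<close>: it comes after the escape
  from the largest ball and lands in the smallest. Balls need not be measurable; a nonmeasurable one
  has \<open>prob\<close> zero and is excluded.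
\<close>

lemma ex_small_slow_set:
  assumes m: "m \<ge> 1" and kdim: "K \<ge> 4 * C * DIM('e) * L + 1"
    and k: "k \<ge> m" "1 / 2 ^ k \<le> \<delta>" and \<eta>: "\<eta> > 0"
  shows "\<exists>D\<in>events. prob D \<le> \<eta> * (1 + (2 * real K + 1) ^ DIM('e)) \<and>
    (\<forall>x\<in>escaping m - D. \<forall>r. 1 / 2 ^ Suc k \<le> r \<longrightarrow> r \<le> 1 / 2 ^ k \<longrightarrow>
       prob (dist_ball (space \<nu>) d x r) > 0 \<longrightarrow>
       return_time (space \<nu>) d \<Psi> r x \<le> ereal ((real m + 1) / 2 ^ k / (\<eta>\<^sup>2 * prob (dist_ball (space \<nu>) d x r))))"
proof -
  \<comment> \<open>With this side, \<open>C\<close> times the \<open>l1\<close> diameter of a cube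
    is a quarter of \<open>1 / 2 ^ k\<close>, less than the smallest radius
    \<open>1 / 2 ^ Suc k\<close>.\<close>
  define s where "s = 1 / (2 ^ k * 4 * C * DIM('e))"
  have s: "s > 0" using pos by (simp add: s_def)
  \<comment> \<open>The index of the cube containing \<open>x\<close>; \<open>restrict\<close> makes
    it an element of a product over \<open>Basis\<close>, so that finitely many indices
    occur.\<close>
  define q where "q x = restrict (\<lambda>b. \<lfloor>\<phi> x \<bullet> b / s\<rfloor>) Basis" for x
  define P where "P z = {x\<in>escaping m. q x = z}" for z
  \<comment> \<open>A measurable block of cubes, wide enough to contain the balls of radius up to
    \<open>1 / 2 ^ k\<close> around the points of \<open>P z\<close>.\<close>
  define N where "N z = {y\<in>U. \<forall>b\<in>Basis. \<bar>\<lfloor>\<phi> y \<bullet> b / s\<rfloor> - z b\<bar> \<le> int K}" for z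
  define Z where "Z = q ` V"
  \<comment> \<open>Strictly more than the bound \<open>m / 2 ^ k\<close> on the escape time, so
    every return under the time \<open>T\<close> map happens after the escape.\<close>
  define T where "T = (real m + 1) / 2 ^ k"
  have finZ: "finite Z"
  proof -
    obtain R where R: "\<And>x. x \<in> V \<Longrightarrow> norm (\<phi> x) \<le> R"
      using coord_bounded by (auto simp: bounded_iff)
    have "q x \<in> (\<Pi>\<^sub>E b\<in>Basis. {\<lfloor>- R / s\<rfloor>..\<lfloor>R / s\<rfloor>})" if "x \<in> V" for x
    proof (rule PiE_I)
      fix b :: 'e assume b: "b \<in> Basis"
      have "\<bar>\<phi> x \<bullet> b\<bar> \<le> R" using R[OF that] Basis_le_norm[OF b, of "\<phi> x"] by linarith
      then have "- R / s \<le> \<phi> x \<bullet> b / s" "\<phi> x \<bullet> b / s \<le> R / s"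
        using s by (auto intro!: divide_right_mono simp del: divide_minus_left)
      then show "q x b \<in> {\<lfloor>- R / s\<rfloor>..\<lfloor>R / s\<rfloor>}"
        using b by (auto simp: q_def intro!: floor_mono simp del: divide_minus_left)
    qed (auto simp: q_def)
    then have "Z \<subseteq> (\<Pi>\<^sub>E b\<in>Basis. {\<lfloor>- R / s\<rfloor>..\<lfloor>R / s\<rfloor>})" by (auto simp: Z_def)
    then show ?thesis by (rule finite_subset) (auto intro!: finite_PiE)
  qed
  let ?f = "\<lambda>x. if x \<in> U then \<phi> x else 0"
  have [measurable]: "?f \<in> borel_measurable \<nu>" "U \<in> events" "escaping m \<in> events"
    by (rule coord_measurable' U escaping_events)+
  have P_ev: "P z \<in> events" if "z \<in> Z" for z
  proof -
    have "P z = {x\<in>space \<nu>. x \<in> escaping m \<and> (\<forall>b\<in>Basis. \<lfloor>?f x \<bullet> b / s\<rfloor> = z b)}"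
    proof -
      have "q x = z \<longleftrightarrow> (\<forall>b\<in>Basis. \<lfloor>\<phi> x \<bullet> b / s\<rfloor> = z b)" for x
      proof -
        have "z \<in> extensional Basis" using that by (auto simp: Z_def q_def)
        then show ?thesis
          unfolding q_def by (auto intro: extensionalityI[of _ Basis])
      qed
      then show ?thesis using V V_space by (auto simp: P_def escaping_def)
    qed
    also have "\<dots> \<in> events" by measurable
    finally show ?thesis .
  qed
  have N_ev: "N z \<in> events" for z
  proof -
    have "N z = {y\<in>space \<nu>. y \<in> U \<and> (\<forall>b\<in>Basis. \<bar>real_of_int \<lfloor>?f y \<bullet> b / s\<rfloor> - real_of_int (z b)\<bar> \<le> real K)}"
    proof -
      have "\<bar>i - j\<bar> \<le> int K \<longleftrightarrow> \<bar>real_of_int i - real_of_int j\<bar> \<le> real K" for i j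
        by linarith
      then show ?thesis using sets.sets_into_space[OF U] by (auto simp: N_def)
    qed
    also have "\<dots> \<in> events" by measurable
    finally show ?thesis .
  qed
  \<comment> \<open>Given \<open>y\<close>, each coordinate of \<open>z\<close> ranges over the
    \<open>2 * K + 1\<close> integers around that of the cube of \<open>y\<close>.\<close>
  have N_card: "card {z\<in>Z. y \<in> N z} \<le> (2 * K + 1) ^ DIM('e)" for y
  proof -
    let ?B = "\<Pi>\<^sub>E b\<in>Basis. {\<lfloor>\<phi> y \<bullet> b / s\<rfloor> - int K..\<lfloor>\<phi> y \<bullet> b / s\<rfloor> + int K}"
    have "{z\<in>Z. y \<in> N z} \<subseteq> ?B"
      by (auto simp: Z_def q_def N_def abs_le_iff)
    then have "card {z\<in>Z. y \<in> N z} \<le> card ?B"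
      by (intro card_mono finite_PiE) auto
    also have "\<dots> = (2 * K + 1) ^ DIM('e)"
      by (simp add: card_PiE nat_add_distrib nat_mult_distrib)
    finally show ?thesis .
  qed
  have "disjoint_family_on P Z"
    by (auto simp: disjoint_family_on_def P_def)
  from ex_small_no_return_set[OF flow_measurable[of T] flow_invariant finZ P_ev this N_ev N_card \<eta>]
  obtain D where D: "D \<in> events" "prob D \<le> \<eta> * (1 + real ((2 * K + 1) ^ DIM('e)))"
    and good: "\<And>z y. z \<in> Z \<Longrightarrow> y \<in> P z - D \<Longrightarrow> prob (P z) > \<eta> * prob (N z) \<and>
              (\<exists>n\<ge>1. (\<Psi> T ^^ n) y \<in> P z \<and> real n \<le> 1 / (\<eta> * prob (P z)))"
    by blast
  have "return_time (space \<nu>) d \<Psi> r x \<le> ereal ((real m + 1) / 2 ^ k / (\<eta>\<^sup>2 * prob (dist_ball (space \<nu>) d x r)))"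
    if x: "x \<in> escaping m - D" and r: "1 / 2 ^ Suc k \<le> r" "r \<le> 1 / 2 ^ k"
      and B: "prob (dist_ball (space \<nu>) d x r) > 0" for x r
  proof -
    let ?B = "dist_ball (space \<nu>) d x r"
    have xV: "x \<in> V" using x by (auto simp: escaping_def)
    have "q x \<in> Z" "x \<in> P (q x) - D" using x xV by (auto simp: Z_def P_def)
    from good[OF this] obtain n where n: "n \<ge> 1" "(\<Psi> T ^^ n) x \<in> P (q x)"
        "real n \<le> 1 / (\<eta> * prob (P (q x)))" and PN: "prob (P (q x)) > \<eta> * prob (N (q x))"
      by blast
    have "?B \<subseteq> N (q x)"
    proof
      fix y assume "y \<in> ?B"
      then have y: "y \<in> space \<nu>" "d x y < ereal (1 / 2 ^ k)"
        using r(2) by (auto simp: dist_ball_def intro: less_le_trans)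
      from coord_less[OF xV y k(2)] have "y \<in> U" and less: "norm (\<phi> y - \<phi> x) < L / 2 ^ k" by auto
      \<comment> \<open>Measured in units of \<open>s\<close> the coordinate changes by at most
        \<open>4 * C * DIM('e) * L\<close>, and taking floors adds at most 1; this dictates the size
        of \<open>K\<close>.\<close>
      have "\<bar>\<lfloor>\<phi> y \<bullet> b / s\<rfloor> - \<lfloor>\<phi> x \<bullet> b / s\<rfloor>\<bar> \<le> int K" if b: "b \<in> Basis" for b
      proof -
        have "\<bar>\<phi> y \<bullet> b - \<phi> x \<bullet> b\<bar> \<le> L / 2 ^ k"
          using Basis_le_norm[OF b, of "\<phi> y - \<phi> x"] less by (simp add: inner_diff_left)
        then have "\<bar>\<phi> y \<bullet> b - \<phi> x \<bullet> b\<bar> / s \<le> L / 2 ^ k / s"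
          using s by (intro divide_right_mono) auto
        also have "L / 2 ^ k / s = 4 * C * DIM('e) * L"
          using pos by (simp add: s_def)
        finally have "\<bar>\<phi> y \<bullet> b / s - \<phi> x \<bullet> b / s\<bar> \<le> 4 * C * DIM('e) * L"
          using s by (simp add: abs_divide diff_divide_distrib[symmetric])
        then have "\<bar>real_of_int \<lfloor>\<phi> y \<bullet> b / s\<rfloor> - \<lfloor>\<phi> x \<bullet> b / s\<rfloor>\<bar> \<le> 4 * C * DIM('e) * L + 1"
          by linarith
        then show ?thesis using kdim by linarith
      qed
      then show "y \<in> N (q x)" using \<open>y \<in> U\<close> by (auto simp: N_def q_def)
    qed
    then have "prob ?B \<le> prob (N (q x))"
      by (intro finite_measure_mono N_ev)
    then have "\<eta> * prob ?B \<le> \<eta> * prob (N (q x))" using \<eta> by (intro mult_left_mono) auto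
    \<comment> \<open>This costs one factor \<open>\<eta>\<close>, the bound on \<open>n\<close> in
      terms of the cell costs another; hence the square in the conclusion.\<close>
    then have P_ge: "\<eta> * prob ?B \<le> prob (P (q x))" using PN by linarith
    then have "1 / (\<eta> * prob (P (q x))) \<le> 1 / (\<eta> * (\<eta> * prob ?B))"
      using B \<eta> by (intro divide_left_mono mult_left_mono) (auto intro!: mult_pos_pos less_le_trans[OF _ P_ge])
    then have n_le: "real n \<le> 1 / (\<eta>\<^sup>2 * prob ?B)"
      using n(3) by (simp add: power2_eq_square mult.assoc)
    let ?t = "real n * T"
    have ret: "\<Psi> ?t x \<in> P (q x)"
      using n(2) flow_funpow V_space[OF xV] by simp
    then have yV: "\<Psi> ?t x \<in> V" by (auto simp: P_def escaping_def)
    \<comment> \<open>Two points of one cube differ by at most \<open>s\<close> in each coordinate,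
      so the return lands in the smallest of the balls.\<close>
    have "norm (\<phi> (\<Psi> ?t x) - \<phi> x) \<le> (\<Sum>b\<in>Basis. \<bar>(\<phi> (\<Psi> ?t x) - \<phi> x) \<bullet> b\<bar>)"
      by (rule norm_le_l1)
    also have "\<dots> \<le> (\<Sum>b\<in>(Basis::'e set). s)"
    proof (rule sum_mono)
      fix b :: 'e assume b: "b \<in> Basis"
      have "q (\<Psi> ?t x) b = q x b" using ret by (simp add: P_def)
      then have "\<lfloor>\<phi> (\<Psi> ?t x) \<bullet> b / s\<rfloor> = \<lfloor>\<phi> x \<bullet> b / s\<rfloor>" using b by (simp add: q_def)
      then have "\<bar>\<phi> (\<Psi> ?t x) \<bullet> b / s - \<phi> x \<bullet> b / s\<bar> \<le> 1" by linarith
      then show "\<bar>(\<phi> (\<Psi> ?t x) - \<phi> x) \<bullet> b\<bar> \<le> s"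
        using s by (simp add: abs_divide diff_divide_distrib[symmetric] inner_diff_left)
    qed
    finally have "C * norm (\<phi> (\<Psi> ?t x) - \<phi> x) \<le> C * (DIM('e) * s)"
      using pos by (intro mult_left_mono) auto
    also have "\<dots> = 1 / 2 ^ k / 4" using pos by (simp add: s_def)
    also have "\<dots> < 1 / 2 ^ Suc k" by (simp add: field_simps)
    finally have "C * norm (\<phi> (\<Psi> ?t x) - \<phi> x) < r" using r(1) by linarith
    then have "d x (\<Psi> ?t x) < ereal r"
      using dist_le[OF xV yV] by (metis ereal_less_eq(3) le_less_trans less_ereal.simps(1))
    then have "\<Psi> ?t x \<in> ?B" using V_space[OF yV] by (simp add: dist_ball_def)
    moreover have "escape_time (space \<nu>) d \<Psi> r x < ereal ?t"
    proof -
      have "real m / 2 ^ k < T" by (simp add: T_def divide_strict_right_mono)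
      also have "1 * T \<le> ?t" using n(1) by (intro mult_right_mono) (auto simp: T_def)
      finally have "ereal (real m / 2 ^ k) < ereal ?t" by simp
      moreover have "escape_time (space \<nu>) d \<Psi> r x \<le> ereal (m / 2 ^ k)"
        using x m k r by (intro escape_time_le) auto
      ultimately show ?thesis by (rule le_less_trans[rotated])
    qed
    ultimately have "return_time (space \<nu>) d \<Psi> r x \<le> ereal ?t"
      unfolding return_time_def by (intro Inf_lower) auto
    also have "ereal ?t \<le> ereal (1 / (\<eta>\<^sup>2 * prob ?B) * T)"
      using n_le by (simp only: ereal_less_eq) (rule mult_right_mono, auto simp: T_def)
    also have "1 / (\<eta>\<^sup>2 * prob ?B) * T = (real m + 1) / 2 ^ k / (\<eta>\<^sup>2 * prob ?B)"
      by (simp add: T_def)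
    finally show ?thesis .
  qed
  moreover have "prob D \<le> \<eta> * (1 + (2 * real K + 1) ^ DIM('e))" using D(2) by (simp add: algebra_simps)
  ultimately show ?thesis
    using D(1) by (intro bexI[of _ D] conjI ballI allI impI)
qed

text \<open>The exceptional sets at the scales \<open>1 / 2 ^ k\<close> have geometrically decaying
  measure, so by Borel-Cantelli almost every point avoids all but finitely many of them. Each small
  \<open>r\<close> is then served by the dyadic scale next to it.\<close>

lemma AE_eventually_return_time_le:
  assumes m: "m \<ge> 1" and \<epsilon>: "\<epsilon> > 0"
  shows "AE x in \<nu>. x \<in> escaping m \<longrightarrow> (\<forall>\<^sub>F r in at_right 0.
    prob (dist_ball (space \<nu>) d x r) > 0 \<longrightarrow>
    return_time (space \<nu>) d \<Psi> r x \<le> ereal (r powr (1 - \<epsilon>) / prob (dist_ball (space \<nu>) d x r)))"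
proof -
  \<comment> \<open>The loss \<open>\<epsilon>\<close> is split into three: two parts pay for the
    square of \<open>\<eta> k\<close>, the third absorbs the constant
    \<open>2 * (real m + 1)\<close>.\<close>
  define \<eta> where "\<eta> k = (1 / 2 ^ k) powr (\<epsilon> / 3)" for k :: nat
  have \<eta>_pos: "\<eta> k > 0" for k by (simp add: \<eta>_def)
  define \<theta> where "\<theta> = (1 / 2 :: real) powr (\<epsilon> / 3)"
  have \<eta>_eq: "\<eta> k = \<theta> ^ k" for k
  proof -
    have "\<eta> k = ((1 / 2) powr real k) powr (\<epsilon> / 3)"
      by (simp add: \<eta>_def powr_realpow power_one_over)
    also have "\<dots> = \<theta> powr real k"
      unfolding \<theta>_def by (simp only: powr_powr mult.commute)
    also have "\<dots> = \<theta> ^ k" by (simp add: powr_realpow \<theta>_def)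
    finally show ?thesis .
  qed
  have \<theta>: "0 < \<theta>" "\<theta> < 1"
    using \<epsilon> powr_less_mono2[of "\<epsilon> / 3" "1 / 2" 1] by (auto simp: \<theta>_def)
  define K where "K = nat \<lceil>4 * C * DIM('e) * L + 1\<rceil>"
  have K: "K \<ge> 4 * C * DIM('e) * L + 1" unfolding K_def by linarith
  have "(\<lambda>k. 1 / 2 ^ k :: real) \<longlonglongrightarrow> 0"
    using LIMSEQ_power_zero[of "1 / 2 :: real"] by (simp add: power_one_over)
  then have "\<forall>\<^sub>F k in sequentially. 1 / 2 ^ k < \<delta>"
    using pos(3) by (rule order_tendstoD)
  then obtain k0 where k0: "\<And>k. k \<ge> k0 \<Longrightarrow> 1 / 2 ^ k \<le> \<delta>"
    by (auto simp: eventually_sequentially intro: less_imp_le)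
  define k1 where "k1 = max m k0"
  define slow where "slow k D \<longleftrightarrow> D \<in> events \<and> prob D \<le> \<eta> k * (1 + (2 * real K + 1) ^ DIM('e)) \<and>
    (\<forall>x\<in>escaping m - D. \<forall>r. 1 / 2 ^ Suc k \<le> r \<longrightarrow> r \<le> 1 / 2 ^ k \<longrightarrow>
       prob (dist_ball (space \<nu>) d x r) > 0 \<longrightarrow>
       return_time (space \<nu>) d \<Psi> r x
         \<le> ereal ((real m + 1) / 2 ^ k / ((\<eta> k)\<^sup>2 * prob (dist_ball (space \<nu>) d x r))))" for k D
  have "\<exists>D. slow k D" if "k \<ge> k1" for k
  proof -
    have "k \<ge> m" "1 / 2 ^ k \<le> \<delta>" using that k0 by (auto simp: k1_def)
    from ex_small_slow_set[OF m K this \<eta>_pos] show ?thesis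
      unfolding slow_def by blast
  qed
  then obtain D where D: "slow k (D k)" if "k \<ge> k1" for k
    by metis
  \<comment> \<open>\<open>D k\<close> is specified only from \<open>k1\<close> on, hence the
    shift.\<close>
  define D' where "D' k = D (k + k1)" for k
  have D': "D' k \<in> events" "prob (D' k) \<le> \<theta> ^ (k + k1) * (1 + (2 * real K + 1) ^ DIM('e))" for k
    using D[of "k + k1"] by (auto simp: slow_def D'_def \<eta>_eq)
  have "summable (\<lambda>k. prob (D' k))"
  proof (rule summable_comparison_test')
    show "summable (\<lambda>k. \<theta> ^ (k + k1) * (1 + (2 * real K + 1) ^ DIM('e)))"
      using \<theta> by (intro summable_mult2 summable_ignore_initial_segment summable_geometric) auto
    show "norm (prob (D' k)) \<le> \<theta> ^ (k + k1) * (1 + (2 * real K + 1) ^ DIM('e))" if "k \<ge> 0" for k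
      using D'(2) by simp
  qed
  then have "AE x in \<nu>. \<forall>\<^sub>F k in sequentially. x \<in> space \<nu> - D' k"
    using D'(1) by (intro borel_cantelli_AE1) (auto simp: emeasure_eq_measure)
  then show ?thesis
  proof (rule AE_mp, intro AE_I2 impI)
    fix x assume ev: "\<forall>\<^sub>F k in sequentially. x \<in> space \<nu> - D' k" and x: "x \<in> escaping m"
    let ?B = "\<lambda>r. dist_ball (space \<nu>) d x r"
    from ev obtain k2 where k2: "\<And>k. k \<ge> k2 \<Longrightarrow> x \<notin> D' k"
      by (auto simp: eventually_sequentially)
    have nD: "x \<notin> D k" if "k \<ge> k1 + k2" for k
      using k2[of "k - k1"] that by (simp add: D'_def)
    have "((\<lambda>r::real. r powr (\<epsilon> / 3)) \<longlongrightarrow> 0) (at_right 0)"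
      using \<epsilon> by (intro tendsto_zero_powrI[of _ _ _ "\<epsilon> / 3"] tendsto_ident_at tendsto_const)
        (auto simp: eventually_at_right_field intro: exI[of _ 1])
    then have "((\<lambda>r::real. 2 * (real m + 1) * r powr (\<epsilon> / 3)) \<longlongrightarrow> 0) (at_right 0)"
      by (rule tendsto_mult_right_zero)
    then have "\<forall>\<^sub>F r in at_right (0::real). 2 * (real m + 1) * r powr (\<epsilon> / 3) < 1"
      by (rule order_tendstoD) simp
    moreover have "\<forall>\<^sub>F r in at_right (0::real). r < 1 / 2 ^ (k1 + k2)"
      by (rule order_tendstoD(2)[OF tendsto_ident_at]) simp
    moreover have "\<forall>\<^sub>F r in at_right (0::real). 0 < r"
      by (simp add: eventually_at_right_less)
    ultimately show "\<forall>\<^sub>F r in at_right 0. prob (?B r) > 0 \<longrightarrow>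
        return_time (space \<nu>) d \<Psi> r x \<le> ereal (r powr (1 - \<epsilon>) / prob (?B r))"
    proof (eventually_elim, intro impI)
      fix r :: real
      assume small: "2 * (real m + 1) * r powr (\<epsilon> / 3) < 1" and r: "r < 1 / 2 ^ (k1 + k2)" "0 < r"
        and B: "prob (?B r) > 0"
      \<comment> \<open>This exponent bounds the elements of \<open>J\<close> below, so that
        \<open>J\<close> has a maximum.\<close>
      obtain b where b: "1 / r < 2 ^ b"
        using real_arch_pow[of 2 "1 / r"] by auto
      have bound: "j \<le> b" if "r \<le> 1 / 2 ^ j" for j
      proof (rule ccontr)
        assume "\<not> j \<le> b"
        then have "r * 2 ^ b \<le> r * 2 ^ j" using r by (intro mult_left_mono power_increasing) auto
        moreover have "r * 2 ^ j \<le> 1" using that by (simp add: field_simps)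
        moreover have "1 < r * 2 ^ b" using b r by (simp add: field_simps)
        ultimately show False by linarith
      qed
      define J where "J = {j. r \<le> 1 / 2 ^ j}"
      have J: "finite J" "k1 + k2 \<in> J"
        using bound r by (auto simp: J_def intro: finite_subset[of _ "{..b}"])
      \<comment> \<open>The finest dyadic scale not below \<open>r\<close>; its maximality gives
        \<open>1 / 2 ^ Suc k \<le> r\<close>.\<close>
      define k where "k = Max J"
      have k: "r \<le> 1 / 2 ^ k" "k \<ge> k1 + k2"
        using Max_in[OF J(1)] Max_ge[OF J] J by (auto simp: k_def J_def)
      have k': "1 / 2 ^ Suc k \<le> r"
      proof (rule ccontr)
        assume "\<not> 1 / 2 ^ Suc k \<le> r"
        then have "Suc k \<in> J" by (simp add: J_def)
        then show False using Max_ge[OF J(1)] by (fastforce simp: k_def)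
      qed
      have "return_time (space \<nu>) d \<Psi> r x \<le> ereal ((real m + 1) / 2 ^ k / ((\<eta> k)\<^sup>2 * prob (?B r)))"
        using D[of k] k k' B x nD[of k] by (auto simp: slow_def)
      also have "(real m + 1) / 2 ^ k / ((\<eta> k)\<^sup>2 * prob (?B r)) \<le> r powr (1 - \<epsilon>) / prob (?B r)"
      proof -
        have "r powr (\<epsilon> / 3) \<le> \<eta> k"
          unfolding \<eta>_def using k r \<epsilon> by (intro powr_mono2) auto
        then have "(r powr (\<epsilon> / 3))\<^sup>2 \<le> (\<eta> k)\<^sup>2" by (intro power_mono) auto
        moreover have "(real m + 1) * (1 / 2 ^ k) \<le> (real m + 1) * (2 * r)"
          using k' by (intro mult_left_mono) auto
        ultimately have "(real m + 1) / 2 ^ k / (\<eta> k)\<^sup>2 \<le> (real m + 1) * (2 * r) / (r powr (\<epsilon> / 3))\<^sup>2"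
          using r by (intro frac_le) auto
        \<comment> \<open>A factor \<open>r powr (\<epsilon> / 3)\<close> is inserted above and
          below the fraction; with the constant it is less than 1, and the cube below is
          \<open>r powr \<epsilon>\<close>.\<close>
        also have "\<dots> = 2 * (real m + 1) * r powr (\<epsilon> / 3) * (r / (r powr (\<epsilon> / 3)) ^ 3)"
          using r by (simp add: field_simps power2_eq_square power3_eq_cube)
        also have "\<dots> \<le> 1 * (r / (r powr (\<epsilon> / 3)) ^ 3)"
          using small r by (intro mult_right_mono) auto
        also have "(r powr (\<epsilon> / 3)) ^ 3 = r powr \<epsilon>"
          using r by (simp add: powr_realpow[symmetric] powr_powr)
        also have "1 * (r / r powr \<epsilon>) = r powr (1 - \<epsilon>)"
          using r by (simp add: powr_diff)
        finally have "(real m + 1) / 2 ^ k / (\<eta> k)\<^sup>2 / prob (?B r) \<le> r powr (1 - \<epsilon>) / prob (?B r)"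
          by (intro divide_right_mono) auto
        then show ?thesis by simp
      qed
      finally show "return_time (space \<nu>) d \<Psi> r x \<le> ereal (r powr (1 - \<epsilon>) / prob (?B r))"
        by simp
    qed
  qed
qed

text \<open>The exceptional null set depends on \<open>\<epsilon>\<close>, so only the countably
  many values \<open>1 / real (Suc n)\<close> are used.\<close>

lemma AE_recurrence_rate_le:
  assumes m: "m \<ge> 1"
  shows "AE x in \<nu>. x \<in> escaping m \<longrightarrow>
    lower_recurrence_rate (space \<nu>) d \<Psi> x \<le> lower_pointwise_dim (space \<nu>) d \<nu> x - 1 \<and>
    upper_recurrence_rate (space \<nu>) d \<Psi> x \<le> upper_pointwise_dim (space \<nu>) d \<nu> x - 1"
proof -
  have "AE x in \<nu>. \<forall>n. x \<in> escaping m \<longrightarrow> (\<forall>\<^sub>F r in at_right 0.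
    prob (dist_ball (space \<nu>) d x r) > 0 \<longrightarrow>
    return_time (space \<nu>) d \<Psi> r x
      \<le> ereal (r powr (1 - 1 / real (Suc n)) / prob (dist_ball (space \<nu>) d x r)))"
    unfolding AE_all_countable using m by (intro allI AE_eventually_return_time_le) auto
  then show ?thesis
    by (rule AE_mp) (intro AE_I2 impI conjI recurrence_rate_le_pointwise_dim; blast)
qed

end

section \<open>Riemannian distance and coordinates\<close>

text \<open>Expanding both vectors in the basis leaves a finite sum of products of continuous
  functions. Needed since smoothness of a metric tensor is stated for fixed vectors, while
  velocities vary along a curve.\<close>

lemma continuous_on_bilinear_form:
  fixes B :: "'p::topological_space \<Rightarrow> 'e::euclidean_space \<Rightarrow> 'e \<Rightarrow> real"
  assumes bil: "\<And>p. p \<in> S \<Longrightarrow> bilinear (B p)"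
    and cont: "\<And>u v. continuous_on S (\<lambda>p. B p u v)"
    and f: "continuous_on T f" "f ` T \<subseteq> S" and u: "continuous_on T u" and v: "continuous_on T v"
  shows "continuous_on T (\<lambda>t. B (f t) (u t) (v t))"
proof -
  have "B (f t) (u t) (v t) = (\<Sum>i\<in>Basis. \<Sum>j\<in>Basis. (u t \<bullet> i) * (v t \<bullet> j) * B (f t) i j)"
    if "t \<in> T" for t
  proof -
    have b: "bilinear (B (f t))" using bil f(2) that by blast
    have "B (f t) (u t) (v t) = B (f t) (\<Sum>i\<in>Basis. (u t \<bullet> i) *\<^sub>R i) (\<Sum>j\<in>Basis. (v t \<bullet> j) *\<^sub>R j)"
      by (simp add: euclidean_representation)
    also have "\<dots> = (\<Sum>(i, j)\<in>Basis \<times> Basis. (u t \<bullet> i) * (v t \<bullet> j) * B (f t) i j)"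
      by (simp add: bilinear_sum[OF b] bilinear_lmul[OF b] bilinear_rmul[OF b] mult_ac)
    finally show ?thesis by (simp add: sum.cartesian_product)
  qed
  moreover have "continuous_on T (\<lambda>t. \<Sum>i\<in>Basis. \<Sum>j\<in>Basis. (u t \<bullet> i) * (v t \<bullet> j) * B (f t) i j)"
  proof -
    have "continuous_on T (\<lambda>t. B (f t) i j)" for i j
      using continuous_on_compose2[OF cont f] .
    then show ?thesis using u v by (intro continuous_intros)
  qed
  ultimately show ?thesis by (metis (no_types, lifting) continuous_on_eq)
qed

text \<open>Integrability is a local property: a small interval around \<open>x\<close> contains no
  break point except possibly \<open>x\<close>, and is split there. The break points need not be
  ordered.\<close>

lemma integrable_on_piecewise:
  fixes f :: "real \<Rightarrow> 'b::banach"
  assumes S: "finite S"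
    and f: "\<And>u v. a \<le> u \<Longrightarrow> u < v \<Longrightarrow> v \<le> b \<Longrightarrow> {u<..<v} \<inter> S = {} \<Longrightarrow> f integrable_on {u..v}"
  shows "f integrable_on {a..b}"
proof -
  have "f integrable_on cbox a b"
  proof (rule integrable_on_little_subintervals, intro ballI)
    fix x assume x: "x \<in> cbox a b"
    obtain e where e: "e > 0" "\<And>s. s \<in> S \<Longrightarrow> s \<noteq> x \<Longrightarrow> e \<le> dist x s"
      using finite_set_avoid[OF S, of x] by metis
    have "f integrable_on cbox u v" if uv: "x \<in> cbox u v" "cbox u v \<subseteq> ball x e" "cbox u v \<subseteq> cbox a b" for u v
    proof -
      have "u \<le> v" "u \<in> cbox u v" "v \<in> cbox u v" using uv(1) by auto
      have "s = x" if "s \<in> S" "s \<in> cbox u v" for s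
        using e(2)[OF that(1)] uv(2) that(2) by (force simp: mem_ball)
      then have no: "{u<..<x} \<inter> S = {}" "{x<..<v} \<inter> S = {}" using uv(1) by force+
      have "a \<le> u" "v \<le> b" using uv \<open>u \<in> cbox u v\<close> \<open>v \<in> cbox u v\<close> by auto
      have "f integrable_on {u..x}"
        using f[of u x] no uv(1) \<open>a \<le> u\<close> \<open>v \<le> b\<close>
        integrable_on_refl[of f x] by (cases "u = x") auto
      moreover have "f integrable_on {x..v}"
        using f[of x v] no uv(1) \<open>a \<le> u\<close> \<open>v \<le> b\<close>
        integrable_on_refl[of f x] by (cases "v = x") auto
      ultimately show ?thesis
        using Henstock_Kurzweil_Integration.integrable_combine[of u x v f] uv(1) by auto
    qed
    then show "\<exists>d>0. \<forall>u v. x \<in> cbox u v \<and> cbox u v \<subseteq> ball x d \<and> cbox u v \<subseteq> cbox a b \<longrightarrow>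
        f integrable_on cbox u v"
      using e(1) by blast
  qed
  then show ?thesis by simp
qed

locale riemannian_manifold =
  fixes M :: "'a::t2_space set" and A :: "('a, 'e::euclidean_space) chart set"
    and g :: "('a, 'e) metric_tensor"
  assumes manifold: "smooth_manifold M A" and metric: "riemannian_metric A g"
begin

section \<open>Charts and the metric tensor in coordinates\<close>

lemma chart: "c \<in> A \<Longrightarrow> is_chart M c"
  using manifold by (simp add: smooth_manifold_def)

lemma chart_dom_openin: "c \<in> A \<Longrightarrow> openin (top_of_set M) (chart_dom c)"
  using chart by (simp add: is_chart_def)

lemma chart_dom_subset: "c \<in> A \<Longrightarrow> chart_dom c \<subseteq> M"
  using chart_dom_openin openin_imp_subset by blast

lemma ex_chart: "x \<in> M \<Longrightarrow> \<exists>c\<in>A. x \<in> chart_dom c"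
  using manifold by (auto simp: smooth_manifold_def)

lemma open_chart_image: "c \<in> A \<Longrightarrow> open (chart_map c ` chart_dom c)"
  using chart by (simp add: is_chart_def)

lemma chart_homeomorphism:
  "c \<in> A \<Longrightarrow> homeomorphism (chart_dom c) (chart_map c ` chart_dom c) (chart_map c) (chart_inv c)"
  using chart by (simp add: is_chart_def)

lemma chart_inv_map [simp]: "c \<in> A \<Longrightarrow> x \<in> chart_dom c \<Longrightarrow> chart_inv c (chart_map c x) = x"
  using chart_homeomorphism by (auto simp: homeomorphism_def)

lemma continuous_chart_map: "c \<in> A \<Longrightarrow> continuous_on (chart_dom c) (chart_map c)"
  using chart_homeomorphism by (auto simp: homeomorphism_def)

lemma continuous_chart_inv: "c \<in> A \<Longrightarrow> continuous_on (chart_map c ` chart_dom c) (chart_inv c)"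
  using chart_homeomorphism by (auto simp: homeomorphism_def)

lemma metric_pos: "c \<in> A \<Longrightarrow> p \<in> chart_dom c \<Longrightarrow> u \<noteq> 0 \<Longrightarrow> g c p u u > 0"
  using metric[unfolded riemannian_metric_def, THEN conjunct1] by simp

lemma metric_bilinear: "c \<in> A \<Longrightarrow> p \<in> chart_dom c \<Longrightarrow> bilinear (g c p)"
  using metric[unfolded riemannian_metric_def, THEN conjunct1] by simp

lemma metric_zero: "c \<in> A \<Longrightarrow> p \<in> chart_dom c \<Longrightarrow> g c p 0 0 = 0"
  by (rule bilinear_lzero[OF metric_bilinear])

lemma metric_nonneg: "c \<in> A \<Longrightarrow> p \<in> chart_dom c \<Longrightarrow> g c p u u \<ge> 0"
  by (cases "u = 0") (simp_all add: metric_zero metric_pos less_imp_le)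

lemma metric_change_chart:
  assumes "c \<in> A" "c' \<in> A" "p \<in> chart_dom c" "p \<in> chart_dom c'"
  shows "g c p u v = g c' p (frechet_derivative (transition c c') (at (chart_map c p)) u)
                            (frechet_derivative (transition c c') (at (chart_map c p)) v)"
  by (rule metric[unfolded riemannian_metric_def, THEN conjunct2, THEN conjunct2, rule_format])
    (use assms in auto)

lemma continuous_metric_coord:
  assumes "c \<in> A"
  shows "continuous_on (chart_map c ` chart_dom c) (\<lambda>y. g c (chart_inv c y) u v)"
proof -
  have "smooth_map_on (\<lambda>y. g c (chart_inv c y) u v) (chart_map c ` chart_dom c)"
    using metric[unfolded riemannian_metric_def, THEN conjunct2, THEN conjunct1] assms by simp
  then show ?thesis unfolding smooth_map_on_def by (metis Ck_on.simps(1))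
qed

lemma continuous_metric:
  assumes c: "c \<in> A" and f: "continuous_on T f" "f ` T \<subseteq> chart_dom c"
    and uv: "continuous_on T u" "continuous_on T v"
  shows "continuous_on T (\<lambda>t. g c (f t) (u t) (v t))"
proof (rule continuous_on_bilinear_form[OF metric_bilinear[OF c] _ f uv])
  fix u v
  have "continuous_on (chart_dom c) (\<lambda>p. g c (chart_inv c (chart_map c p)) u v)"
    by (rule continuous_on_compose2[OF continuous_metric_coord[OF c] continuous_chart_map[OF c]]) auto
  then show "continuous_on (chart_dom c) (\<lambda>p. g c p u v)"
    by (rule continuous_on_eq) (simp add: c)
qed

text \<open>On the compact product of \<open>K\<close> with the unit sphere the length of a vector
  attains a positive minimum and a maximum; homogeneity extends the bounds to all vectors.\<close>

lemma metric_norm_equiv: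
  assumes c: "c \<in> A" and K: "compact K" "K \<subseteq> chart_map c ` chart_dom c"
  obtains l u where "l > 0" "u > 0"
    "\<And>y w. y \<in> K \<Longrightarrow> l * norm w \<le> sqrt (g c (chart_inv c y) w w)"
    "\<And>y w. y \<in> K \<Longrightarrow> sqrt (g c (chart_inv c y) w w) \<le> u * norm w"
proof (cases "K = {}")
  case True
  then show ?thesis using that[of 1 1] by simp
next
  case False
  define f where "f = (\<lambda>(y, w). sqrt (g c (chart_inv c y) w w))"
  let ?S = "K \<times> sphere (0::'e) 1"
  have S: "compact ?S" "?S \<noteq> {}" using K False by (auto intro: compact_Times)
  have inv: "chart_inv c y \<in> chart_dom c" if "y \<in> K" for y
    using K(2) that c by auto
  have cont: "continuous_on ?S f"
  proof -
    have "continuous_on ?S (\<lambda>p. chart_inv c (fst p))"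
      using K(2) by (intro continuous_on_compose2[OF continuous_chart_inv[OF c]] continuous_intros) auto
    then have "continuous_on ?S (\<lambda>p. g c (chart_inv c (fst p)) (snd p) (snd p))"
      using inv by (intro continuous_metric c continuous_intros) auto
    then show ?thesis unfolding f_def case_prod_beta by (intro continuous_intros)
  qed
  obtain p where p: "p \<in> ?S" "\<And>q. q \<in> ?S \<Longrightarrow> f p \<le> f q"
    using continuous_attains_inf[OF S cont] by blast
  obtain p' where p': "p' \<in> ?S" "\<And>q. q \<in> ?S \<Longrightarrow> f q \<le> f p'"
    using continuous_attains_sup[OF S cont] by blast
  have pos: "f q > 0" if "q \<in> ?S" for q
    using that inv by (auto simp: f_def intro!: metric_pos[OF c])
  have hom: "sqrt (g c (chart_inv c y) w w) = norm w * f (y, w /\<^sub>R norm w)" if "y \<in> K" "w \<noteq> 0" for y w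
  proof -
    note b = metric_bilinear[OF c inv[OF that(1)]]
    have "g c (chart_inv c y) w w = (norm w)\<^sup>2 * g c (chart_inv c y) (w /\<^sub>R norm w) (w /\<^sub>R norm w)"
      using that(2) by (simp add: bilinear_lmul[OF b] bilinear_rmul[OF b] power2_eq_square field_simps)
    then show ?thesis by (simp add: f_def real_sqrt_mult)
  qed
  have zero: "g c (chart_inv c y) 0 0 = 0" if "y \<in> K" for y
    using bilinear_lzero[OF metric_bilinear[OF c inv[OF that]]] .
  have mem: "(y, w /\<^sub>R norm w) \<in> ?S" if "y \<in> K" "w \<noteq> 0" for y w
    using that by simp
  show ?thesis
  proof (rule that[of "f p" "f p'"])
    show "f p * norm w \<le> sqrt (g c (chart_inv c y) w w)" if "y \<in> K" for y w
      using hom[OF that, of w] p(2)[OF mem[OF that]] zero[OF that]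
      by (cases "w = 0") (auto simp: mult.commute[of "f p"] intro!: mult_left_mono)
    show "sqrt (g c (chart_inv c y) w w) \<le> f p' * norm w" if "y \<in> K" for y w
      using hom[OF that, of w] p'(2)[OF mem[OF that]] zero[OF that]
      by (cases "w = 0") (auto simp: mult.commute[of "f p'"] intro!: mult_left_mono)
    show "f p > 0" "f p' > 0" using pos p(1) p'(1) by blast+
  qed
qed

section \<open>Curves under a change of chart, their speed and length\<close>

lemma transition_has_derivative:
  assumes "c \<in> A" "c' \<in> A" "p \<in> chart_dom c" "p \<in> chart_dom c'"
  shows "(transition c c' has_derivative frechet_derivative (transition c c') (at (chart_map c p)))
           (at (chart_map c p))"
proof -
  have "smooth_map_on (transition c c') (chart_map c ` (chart_dom c \<inter> chart_dom c'))"
    using manifold assms by (auto simp: smooth_manifold_def)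
  then have "Ck_on (Suc 0) (transition c c') (chart_map c ` (chart_dom c \<inter> chart_dom c'))"
    unfolding smooth_map_on_def by blast
  then have "transition c c' differentiable (at (chart_map c p))"
    using assms by auto
  then show ?thesis by (simp add: frechet_derivative_works)
qed

lemma continuous_transition_derivative:
  assumes "c \<in> A" "c' \<in> A"
  shows "continuous_on (chart_map c ` (chart_dom c \<inter> chart_dom c'))
    (\<lambda>x. frechet_derivative (transition c c') (at x) v)"
proof -
  have "smooth_map_on (transition c c') (chart_map c ` (chart_dom c \<inter> chart_dom c'))"
    using manifold assms by (auto simp: smooth_manifold_def)
  then have "Ck_on (Suc 0) (transition c c') (chart_map c ` (chart_dom c \<inter> chart_dom c'))"
    unfolding smooth_map_on_def by blast
  then show ?thesis by auto
qed

text \<open>Chart domains are open only relative to \<open>M\<close>, so the curve has to stay in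
  \<open>M\<close>.\<close>

lemma eventually_in_chart_dom:
  fixes \<gamma> :: "real \<Rightarrow> 'a"
  assumes c: "c \<in> A" and \<gamma>: "continuous_on I \<gamma>" "\<gamma> ` I \<subseteq> M" and t: "t \<in> I" "\<gamma> t \<in> chart_dom c"
  obtains e where "e > 0" "\<And>s. s \<in> I \<Longrightarrow> dist s t < e \<Longrightarrow> \<gamma> s \<in> chart_dom c"
proof -
  obtain W where W: "open W" "chart_dom c = M \<inter> W"
    using chart_dom_openin[OF c] by (auto simp: openin_open)
  have "openin (top_of_set I) (I \<inter> \<gamma> -` W)"
    using \<gamma>(1) W(1) by (rule continuous_openin_preimage_gen)
  moreover have "t \<in> I \<inter> \<gamma> -` W" using t W by auto
  ultimately obtain e where "e > 0" "\<And>s. s \<in> I \<Longrightarrow> dist s t < e \<Longrightarrow> s \<in> I \<inter> \<gamma> -` W"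
    unfolding openin_euclidean_subtopology_iff by blast
  then show ?thesis using that[of e] \<gamma>(2) W(2) by blast
qed

text \<open>Chain rule for the transition map; the two coordinate curves are related by it only near
  \<open>t\<close>, where the curve is still in the domain of \<open>c\<close>.\<close>

lemma has_vector_derivative_change_chart:
  fixes \<gamma> :: "real \<Rightarrow> 'a"
  assumes c: "c \<in> A" "c' \<in> A" and \<gamma>: "continuous_on I \<gamma>" "\<gamma> ` I \<subseteq> M"
    and t: "t \<in> I" "\<gamma> t \<in> chart_dom c" "\<gamma> t \<in> chart_dom c'"
    and v: "((\<lambda>s. chart_map c (\<gamma> s)) has_vector_derivative v) (at t within I)"
  shows "((\<lambda>s. chart_map c' (\<gamma> s)) has_vector_derivative
           frechet_derivative (transition c c') (at (chart_map c (\<gamma> t))) v) (at t within I)"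
proof -
  obtain e where e: "e > 0" "\<And>s. s \<in> I \<Longrightarrow> dist s t < e \<Longrightarrow> \<gamma> s \<in> chart_dom c"
    using eventually_in_chart_dom[OF c(1) \<gamma> t(1,2)] by blast
  have "((transition c c' \<circ> (\<lambda>s. chart_map c (\<gamma> s))) has_vector_derivative
      frechet_derivative (transition c c') (at (chart_map c (\<gamma> t))) v) (at t within I)"
    using v transition_has_derivative[OF c t(2,3)]
    by (intro vector_derivative_diff_chain_within) (auto intro: has_derivative_at_withinI)
  then show ?thesis
    using e(1) t(1) by (rule has_vector_derivative_transform_within)
      (simp add: transition_def c e(2))
qed

text \<open>\<open>curve_speed\<close> relative to an arbitrary interval. On a closed piece between
  break points the one-sided derivatives at the ends exist, whereas relative to
  \<open>{0..1}\<close> they may not.\<close>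

definition speed_within :: "real set \<Rightarrow> (real \<Rightarrow> 'a) \<Rightarrow> real \<Rightarrow> real" where
  "speed_within I \<gamma> t =
     (let c = (SOME c. c \<in> A \<and> \<gamma> t \<in> chart_dom c);
          v = vector_derivative (\<lambda>s. chart_map c (\<gamma> s)) (at t within I)
      in sqrt (g c (\<gamma> t) v v))"

lemma curve_speed_eq: "curve_speed A g \<gamma> = speed_within {0..1} \<gamma>"
  by (simp add: curve_speed_def speed_within_def fun_eq_iff)

lemma speed_nonneg: "\<gamma> t \<in> M \<Longrightarrow> speed_within I \<gamma> t \<ge> 0"
proof -
  assume "\<gamma> t \<in> M"
  then have "\<exists>c. c \<in> A \<and> \<gamma> t \<in> chart_dom c" using ex_chart by blast
  from someI_ex[OF this] show ?thesis
    unfolding speed_within_def Let_def by (intro real_sqrt_ge_zero metric_nonneg) simp_all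
qed

text \<open>The chart picked by \<open>SOME\<close> may be replaced by any other, because the local
  expressions of the metric agree under the derivative of the transition map. The condition
  \<open>a < b\<close> makes derivatives within the interval unique.\<close>

lemma speed_within_chart:
  assumes c: "c \<in> A" and ab: "a < b" and \<gamma>: "continuous_on {a..b} \<gamma>" "\<gamma> ` {a..b} \<subseteq> M"
    and t: "t \<in> {a..b}" "\<gamma> t \<in> chart_dom c"
    and v: "((\<lambda>s. chart_map c (\<gamma> s)) has_vector_derivative v) (at t within {a..b})"
  shows "speed_within {a..b} \<gamma> t = sqrt (g c (\<gamma> t) v v)"
proof -
  define c' where "c' = (SOME c. c \<in> A \<and> \<gamma> t \<in> chart_dom c)"
  have c': "c' \<in> A" "\<gamma> t \<in> chart_dom c'"
    using someI[of "\<lambda>c. c \<in> A \<and> \<gamma> t \<in> chart_dom c" c] c t by (auto simp: c'_def)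
  define v' where "v' = frechet_derivative (transition c c') (at (chart_map c (\<gamma> t))) v"
  have "((\<lambda>s. chart_map c' (\<gamma> s)) has_vector_derivative v') (at t within {a..b})"
    unfolding v'_def by (rule has_vector_derivative_change_chart) (use assms c' in auto)
  then have "vector_derivative (\<lambda>s. chart_map c' (\<gamma> s)) (at t within {a..b}) = v'"
    using ab t by (intro vector_derivative_within_closed_interval)
  then have "speed_within {a..b} \<gamma> t = sqrt (g c' (\<gamma> t) v' v')"
    by (simp add: speed_within_def c'_def Let_def)
  also have "g c' (\<gamma> t) v' v' = g c (\<gamma> t) v v"
    unfolding v'_def by (rule metric_change_chart[symmetric]) (use c c' t in auto)
  finally show ?thesis .
qed

text \<open>The chart picked by \<open>SOME\<close> may jump along the curve, but near each
  \<open>t\<close> the speed can be computed in one fixed chart.\<close>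

lemma continuous_speed_within:
  assumes ab: "a < b" and \<gamma>: "continuous_on {a..b} \<gamma>" "\<gamma> ` {a..b} \<subseteq> M" and C1: "C1_curve A a b \<gamma>"
  shows "continuous_on {a..b} (speed_within {a..b} \<gamma>)"
  unfolding continuous_on_eq_continuous_within
proof
  fix t assume t: "t \<in> {a..b}"
  obtain c where c: "c \<in> A" "\<gamma> t \<in> chart_dom c" using ex_chart \<gamma>(2) t by blast
  let ?I = "{t \<in> {a..b}. \<gamma> t \<in> chart_dom c}"
  obtain D where D: "continuous_on ?I D"
    "\<And>t. t \<in> ?I \<Longrightarrow> ((\<lambda>s. chart_map c (\<gamma> s)) has_vector_derivative D t) (at t within {a..b})"
    using C1 c(1) unfolding C1_curve_def by (metis (no_types, lifting) mem_Collect_eq)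
  obtain e where e: "e > 0" "\<And>s. s \<in> {a..b} \<Longrightarrow> dist s t < e \<Longrightarrow> \<gamma> s \<in> chart_dom c"
    using eventually_in_chart_dom[OF c(1) \<gamma> t c(2)] by blast
  have "continuous_on ?I (\<lambda>s. sqrt (g c (\<gamma> s) (D s) (D s)))"
  proof (intro continuous_intros continuous_metric c(1) D(1))
    show "continuous_on ?I \<gamma>" using \<gamma>(1) by (rule continuous_on_subset) auto
  qed auto
  then have "continuous_on ?I (speed_within {a..b} \<gamma>)"
  proof (rule continuous_on_eq)
    fix s assume "s \<in> ?I"
    then show "sqrt (g c (\<gamma> s) (D s) (D s)) = speed_within {a..b} \<gamma> s"
      using speed_within_chart[OF c(1) ab \<gamma> _ _ D(2)] by simp
  qed
  then have "continuous (at t within ?I) (speed_within {a..b} \<gamma>)"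
    using t c(2) by (simp add: continuous_on_eq_continuous_within)
  moreover have "at t within ?I = at t within {a..b}"
    using e by (intro at_within_nhd[of _ "ball t e"]) (auto simp: dist_commute)
  ultimately show "continuous (at t within {a..b}) (speed_within {a..b} \<gamma>)" by simp
qed

text \<open>Without this, \<open>integral\<close> would take its default value 0 and
  \<open>curve_length\<close> would bound nothing from above.\<close>

lemma curve_speed_integrable:
  assumes \<gamma>: "piecewise_C1_path M A \<gamma>"
  shows "curve_speed A g \<gamma> integrable_on {0..1}"
proof -
  have cont: "continuous_on {0..1} \<gamma>" "\<gamma> ` {0..1} \<subseteq> M"
    using \<gamma> by (auto simp: piecewise_C1_path_def path_def path_image_def)
  obtain S where S: "finite S"
    "\<And>a b. 0 \<le> a \<Longrightarrow> a < b \<Longrightarrow> b \<le> 1 \<Longrightarrow> {a<..<b} \<inter> S = {} \<Longrightarrow> C1_curve A a b \<gamma>"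
    using \<gamma> unfolding piecewise_C1_path_def by blast
  show ?thesis
  proof (rule integrable_on_piecewise[OF S(1)])
    fix a b :: real assume ab: "0 \<le> a" "a < b" "b \<le> 1" "{a<..<b} \<inter> S = {}"
    have \<gamma>': "continuous_on {a..b} \<gamma>" "\<gamma> ` {a..b} \<subseteq> M"
      using cont ab by (auto intro: continuous_on_subset)
    have C1: "C1_curve A a b \<gamma>" using S(2) ab by blast
    have "speed_within {a..b} \<gamma> integrable_on {a..b}"
      using continuous_speed_within[OF ab(2) \<gamma>' C1] by (rule integrable_continuous_real)
    \<comment> \<open>In the interior both speeds use the two-sided derivative; at the two ends,
      where there may be a corner, they can differ.\<close>
    moreover have "curve_speed A g \<gamma> t = speed_within {a..b} \<gamma> t" if "t \<in> {a..b} - {a, b}" for t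
      using that ab by (auto simp: curve_speed_eq speed_within_def at_within_Icc_at)
    ultimately show "curve_speed A g \<gamma> integrable_on {a..b}"
      using integrable_spike_finite[of "{a, b}" "{a..b}" "curve_speed A g \<gamma>" "speed_within {a..b} \<gamma>"]
      by blast
  qed
qed

text \<open>The displacement in coordinates is the integral of the velocity, whose norm times
  \<open>l\<close> is at most the speed. Only the arc up to \<open>t\<close> has to lie in
  \<open>K\<close>, as required in a first exit argument.\<close>

lemma coord_dist_le_curve_length:
  assumes c: "c \<in> A" and l: "l > 0"
    and K: "\<And>y w. y \<in> K \<Longrightarrow> l * norm w \<le> sqrt (g c (chart_inv c y) w w)"
    and \<gamma>: "piecewise_C1_path M A \<gamma>" and t: "0 \<le> t" "t \<le> 1"
    and sub: "\<And>s. 0 \<le> s \<Longrightarrow> s \<le> t \<Longrightarrow> \<gamma> s \<in> chart_dom c \<and> chart_map c (\<gamma> s) \<in> K"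
  shows "l * norm (chart_map c (\<gamma> t) - chart_map c (\<gamma> 0)) \<le> curve_length A g \<gamma>"
proof -
  have cont: "continuous_on {0..1} \<gamma>" "\<gamma> ` {0..1} \<subseteq> M"
    using \<gamma> by (auto simp: piecewise_C1_path_def path_def path_image_def)
  obtain S where S: "finite S"
    "\<And>a b. 0 \<le> a \<Longrightarrow> a < b \<Longrightarrow> b \<le> 1 \<Longrightarrow> {a<..<b} \<inter> S = {} \<Longrightarrow> C1_curve A a b \<gamma>"
    using \<gamma> unfolding piecewise_C1_path_def by blast
  let ?h = "\<lambda>s. chart_map c (\<gamma> s)"
  \<comment> \<open>The default 0 is taken on a finite subset of \<open>{0..t}\<close>, which the
    fundamental theorem tolerates, and the bound by the speed is trivial there.\<close>
  define h' where "h' s = (if s \<in> {0<..<t} - S then vector_derivative ?h (at s) else 0)" for s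
  have deriv: "(?h has_vector_derivative h' s) (at s)" if s: "s \<in> {0<..<t} - S" for s
  proof -
    obtain e where e: "e > 0" "\<And>q. q \<in> S \<Longrightarrow> q \<noteq> s \<Longrightarrow> e \<le> dist s q"
      using finite_set_avoid[OF S(1), of s] by metis
    \<comment> \<open>Keeps the interval around \<open>s\<close> inside \<open>{0..1}\<close> and
      free of break points; the derivative on this closed piece is then two-sided at
      \<open>s\<close>.\<close>
    define e' where "e' = min e (min s (1 - s))"
    have e': "e' > 0" "e' \<le> e" "e' \<le> s" "e' \<le> 1 - s" using e s t by (auto simp: e'_def)
    have "{s - e'<..<s + e'} \<inter> S = {}"
    proof (rule ccontr)
      assume "{s - e'<..<s + e'} \<inter> S \<noteq> {}"
      then obtain q where q: "q \<in> S" "q \<in> {s - e'<..<s + e'}" by blast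
      then have "\<bar>s - q\<bar> < e'" "q \<noteq> s" using s by auto
      with q(1) show False using e(2)[of q] e'(2) by (simp add: dist_real_def)
    qed
    then have "C1_curve A (s - e') (s + e') \<gamma>" using e' by (intro S(2)) auto
    moreover have "s \<in> {s - e'..s + e'}" "\<gamma> s \<in> chart_dom c" using e' sub[of s] s by auto
    ultimately obtain D where "(?h has_vector_derivative D) (at s within {s - e'..s + e'})"
      using c unfolding C1_curve_def by blast
    then have "(?h has_vector_derivative D) (at s)"
      using e' by (simp add: at_within_Icc_at)
    then show ?thesis using s by (simp add: h'_def vector_derivative_at)
  qed
  have "continuous_on {0..t} ?h"
    using sub t by (intro continuous_on_compose2[OF continuous_chart_map[OF c]] continuous_on_subset[OF cont(1)]) auto
  then have int: "(h' has_integral ?h t - ?h 0) {0..t}"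
    using S(1) t(1) deriv by (intro fundamental_theorem_of_calculus_interior_strong[of S])
  have speed: "norm (l *\<^sub>R h' s) \<le> curve_speed A g \<gamma> s" if s: "s \<in> {0..t}" for s
  proof (cases "s \<in> {0<..<t} - S")
    case True
    have "curve_speed A g \<gamma> s = sqrt (g c (\<gamma> s) (h' s) (h' s))"
      unfolding curve_speed_eq
      by (rule speed_within_chart) (use c cont sub[of s] s t deriv[OF True] in
          \<open>auto intro: has_vector_derivative_at_within\<close>)
    moreover have "chart_inv c (?h s) = \<gamma> s" using c sub[of s] s by simp
    moreover have "?h s \<in> K" using sub[of s] s by simp
    ultimately show ?thesis using K[of "?h s" "h' s"] l by simp
  next
    case False
    then have "h' s = 0" unfolding h'_def by (rule if_not_P)
    moreover have "\<gamma> s \<in> M" using cont(2) s t by auto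
    ultimately show ?thesis using speed_nonneg[of \<gamma> s] by (simp add: curve_speed_eq)
  qed
  have int01: "curve_speed A g \<gamma> integrable_on {0..1}"
    by (rule curve_speed_integrable[OF \<gamma>])
  have int0t: "curve_speed A g \<gamma> integrable_on {0..t}"
    by (rule integrable_on_subinterval[OF int01]) (use t in auto)
  have "l * norm (?h t - ?h 0) = norm (l *\<^sub>R integral {0..t} h')"
    using int l by (simp add: integral_unique)
  also have "l *\<^sub>R integral {0..t} h' = integral {0..t} (\<lambda>s. l *\<^sub>R h' s)"
    by (simp add: integral_cmul)
  also have "norm (integral {0..t} (\<lambda>s. l *\<^sub>R h' s)) \<le> integral {0..t} (curve_speed A g \<gamma>)"
    using int int0t speed
    by (intro Henstock_Kurzweil_Integration.integral_norm_bound_integral integrable_cmul)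
      (auto simp: integrable_on_def)
  also have "\<dots> \<le> integral {0..1} (curve_speed A g \<gamma>)"
    using int01 int0t t cont(2) by (intro integral_subset_le) (auto simp: curve_speed_eq intro!: speed_nonneg)
  finally show ?thesis by (simp add: curve_length_def)
qed

section \<open>Comparison of the Riemannian distance with the norm in coordinates\<close>

lemma openin_chart_ball:
  assumes c: "c \<in> A"
  shows "openin (top_of_set M) {p \<in> chart_dom c. chart_map c p \<in> ball z r}"
proof -
  have "openin (top_of_set (chart_dom c)) (chart_dom c \<inter> chart_map c -` ball z r)"
    using continuous_chart_map[OF c] by (intro continuous_openin_preimage_gen) auto
  moreover have "chart_dom c \<inter> chart_map c -` ball z r = {p \<in> chart_dom c. chart_map c p \<in> ball z r}"
    by auto
  ultimately show ?thesis using openin_trans chart_dom_openin[OF c] by metis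
qed

text \<open>Leaving the coordinate ball of radius \<open>\<rho>\<close> costs length at least
  \<open>l * \<rho>\<close>, so a path shorter than \<open>r\<close> stays inside and its length
  controls the coordinates of its end.\<close>

lemma riemannian_dist_less_imp:
  assumes c: "c \<in> A" and l: "l > 0" and \<rho>: "\<rho> > 0"
    and K: "\<And>y w. y \<in> K \<Longrightarrow> l * norm w \<le> sqrt (g c (chart_inv c y) w w)"
    and x: "x \<in> chart_dom c" "cball (chart_map c x) \<rho> \<subseteq> K" "K \<subseteq> chart_map c ` chart_dom c"
    and d: "riemannian_dist M A g x y < ereal r" "r \<le> l * \<rho>"
  shows "y \<in> chart_dom c \<and> norm (chart_map c y - chart_map c x) < r / l"
proof -
  let ?B = "ball (chart_map c x) \<rho>" and ?C = "cball (chart_map c x) \<rho>"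
  obtain \<gamma> where \<gamma>: "piecewise_C1_path M A \<gamma>" "\<gamma> 0 = x" "\<gamma> 1 = y"
      and len: "curve_length A g \<gamma> < r"
    using d(1) unfolding riemannian_dist_def INF_less_iff by (auto simp: pathstart_def pathfinish_def)
  have cont: "continuous_on {0..1} \<gamma>" "\<gamma> ` {0..1} \<subseteq> M"
    using \<gamma>(1) by (auto simp: piecewise_C1_path_def path_def path_image_def)
  have less: "norm (chart_map c (\<gamma> t) - chart_map c x) < r / l"
    if "0 \<le> t" "t \<le> 1" "\<And>s. 0 \<le> s \<Longrightarrow> s \<le> t \<Longrightarrow> \<gamma> s \<in> chart_dom c \<and> chart_map c (\<gamma> s) \<in> ?C" for t
  proof -
    have "l * norm (chart_map c (\<gamma> t) - chart_map c (\<gamma> 0)) \<le> curve_length A g \<gamma>"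
      using that x(2) by (intro coord_dist_le_curve_length[OF c l K \<gamma>(1)]) auto
    then have "l * norm (chart_map c (\<gamma> t) - chart_map c x) < r" using len \<gamma>(2) by simp
    then show ?thesis using l by (simp add: field_simps)
  qed
  define W where "W = {p \<in> chart_dom c. chart_map c p \<in> ?B}"
  have "openin (top_of_set M) W" unfolding W_def by (rule openin_chart_ball[OF c])
  then obtain O' where O': "open O'" "W = M \<inter> O'" by (auto simp: openin_open)
  have inW: "\<gamma> t \<in> W" if "t \<in> {0..1}" for t
  proof (rule ccontr)
    assume "\<gamma> t \<notin> W"
    \<comment> \<open>The times spent outside \<open>W\<close>; being closed, the set has a least
      element, the first exit time.\<close>
    define T where "T = {0..1} \<inter> \<gamma> -` (- O')"
    have "closed T" unfolding T_def
      using cont(1) O'(1) by (intro continuous_closed_preimage) auto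
    have T_eq: "s \<in> T \<longleftrightarrow> s \<in> {0..1} \<and> \<gamma> s \<notin> W" for s
      using cont(2) O'(2) by (auto simp: T_def image_subset_iff)
    have "t \<in> T" using \<open>\<gamma> t \<notin> W\<close> that by (simp add: T_eq)
    define t1 where "t1 = Inf T"
    have bdd: "bdd_below T" by (rule bdd_belowI[of _ 0]) (simp add: T_def)
    have t1: "t1 \<in> T" unfolding t1_def
      using \<open>closed T\<close> \<open>t \<in> T\<close> bdd by (intro closed_contains_Inf) auto
    have before: "\<gamma> s \<in> W" if "0 \<le> s" "s < t1" for s
    proof (rule ccontr)
      assume "\<gamma> s \<notin> W"
      then have "s \<in> T" using that t1 by (auto simp: T_eq)
      then have "t1 \<le> s" unfolding t1_def using bdd by (rule cInf_lower)
      then show False using that by simp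
    qed
    have "x \<in> W" using x(1) \<rho> by (simp add: W_def)
    then have "t1 \<noteq> 0" using t1 \<gamma>(2) by (auto simp: T_eq)
    then have t1_pos: "0 < t1" "t1 \<le> 1" using t1 by (auto simp: T_eq)
    \<comment> \<open>At the exit time the path might have left the chart altogether. The compact
      set \<open>Q\<close> is closed in the Hausdorff space and contains the path before
      \<open>t1\<close>, hence also the point at \<open>t1\<close>, so the length estimate applies
      up to that time.\<close>
    define Q where "Q = chart_inv c ` ?C"
    have C_sub: "?C \<subseteq> chart_map c ` chart_dom c" using x by blast
    have "compact Q" unfolding Q_def
      by (intro compact_continuous_image continuous_on_subset[OF continuous_chart_inv[OF c] C_sub]) simp
    then have "closed Q" by (rule compact_imp_closed)
    have Q: "p \<in> chart_dom c \<and> chart_map c p \<in> ?C" if "p \<in> Q" for p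
    proof -
      obtain z where z: "z \<in> ?C" "p = chart_inv c z" using \<open>p \<in> Q\<close> by (auto simp: Q_def)
      then obtain q where q: "q \<in> chart_dom c" "z = chart_map c q" using C_sub by blast
      then have "p = q" using c z(2) by simp
      then show ?thesis using q z(1) by simp
    qed
    have WQ: "W \<subseteq> Q"
    proof
      fix p assume "p \<in> W"
      then have "p = chart_inv c (chart_map c p)" "chart_map c p \<in> ?C" using c by (auto simp: W_def)
      then show "p \<in> Q" unfolding Q_def by blast
    qed
    have "closed ({0..1} \<inter> \<gamma> -` Q)"
      using cont(1) \<open>closed Q\<close> by (intro continuous_closed_preimage) auto
    moreover have "{0..<t1} \<subseteq> {0..1} \<inter> \<gamma> -` Q" using subsetD[OF WQ before] t1_pos by auto
    ultimately have "closure {0..<t1} \<subseteq> {0..1} \<inter> \<gamma> -` Q" by (rule closure_minimal[rotated])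
    then have "\<gamma> s \<in> Q" if "0 \<le> s" "s \<le> t1" for s
      using that t1_pos by auto
    then have "norm (chart_map c (\<gamma> t1) - chart_map c x) < r / l" "\<gamma> t1 \<in> chart_dom c"
      using Q t1_pos by (auto intro!: less)
    moreover have "r / l \<le> \<rho>" using d(2) l by (simp add: field_simps)
    ultimately have "\<gamma> t1 \<in> W"
      by (simp add: W_def dist_norm norm_minus_commute)
    then show False using t1 by (simp add: T_eq)
  qed
  then have "\<And>s. 0 \<le> s \<Longrightarrow> s \<le> 1 \<Longrightarrow> \<gamma> s \<in> chart_dom c \<and> chart_map c (\<gamma> s) \<in> ?C"
    by (force simp: W_def)
  from less[OF _ _ this, of 1] this[of 1] show ?thesis using \<gamma>(3) by simp
qed

text \<open>The segment between the coordinates, pulled back to the manifold, is an admissible path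
  of speed at most \<open>u\<close> times the norm of the difference.\<close>

lemma riemannian_dist_le:
  assumes c: "c \<in> A" and u: "u > 0"
    and K: "\<And>y w. y \<in> K \<Longrightarrow> sqrt (g c (chart_inv c y) w w) \<le> u * norm w"
    and xy: "x \<in> chart_dom c" "y \<in> chart_dom c"
    and seg: "closed_segment (chart_map c x) (chart_map c y) \<subseteq> K" "K \<subseteq> chart_map c ` chart_dom c"
  shows "riemannian_dist M A g x y \<le> ereal (u * norm (chart_map c y - chart_map c x))"
proof -
  let ?p = "chart_map c x" and ?w = "chart_map c y - chart_map c x"
  define f where "f t = ?p + t *\<^sub>R ?w" for t :: real
  define \<gamma> where "\<gamma> t = chart_inv c (f t)" for t
  have f_K: "f t \<in> K" if "t \<in> {0..1}" for t
  proof -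
    have "f t = (1 - t) *\<^sub>R chart_map c x + t *\<^sub>R chart_map c y"
      by (simp add: f_def algebra_simps)
    then have "f t \<in> closed_segment (chart_map c x) (chart_map c y)"
      using that by (auto simp: closed_segment_def)
    then show ?thesis using seg(1) by blast
  qed
  have inv: "chart_inv c z \<in> chart_dom c" "chart_map c (chart_inv c z) = z" if "z \<in> K" for z
    using seg(2) that c by auto
  have \<gamma>_dom: "\<gamma> t \<in> chart_dom c" "chart_map c (\<gamma> t) = f t" if "t \<in> {0..1}" for t
    using inv[OF f_K[OF that]] by (auto simp: \<gamma>_def)
  have f_cont: "continuous_on T f" for T unfolding f_def by (intro continuous_intros)
  have f_deriv: "(f has_vector_derivative ?w) (at t within T)" for t T
    unfolding f_def by (auto intro!: derivative_eq_intros)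
  have cont: "continuous_on {0..1} \<gamma>"
    unfolding \<gamma>_def using f_K seg(2)
    by (intro continuous_on_compose2[OF continuous_chart_inv[OF c]] f_cont) auto
  have \<gamma>_M: "\<gamma> ` {0..1} \<subseteq> M" using \<gamma>_dom chart_dom_subset[OF c] by auto
  have coord: "((\<lambda>s. chart_map c (\<gamma> s)) has_vector_derivative ?w) (at t within {a..b})"
    if "t \<in> {a..b}" "0 \<le> a" "b \<le> 1" for t a b
    by (rule has_vector_derivative_transform_within[OF f_deriv zero_less_one that(1)])
      (use that \<gamma>_dom in auto)
  have C1: "C1_curve A a b \<gamma>" if ab: "0 \<le> a" "a < b" "b \<le> 1" for a b
    unfolding C1_curve_def
  proof
    fix c' assume c': "c' \<in> A"
    \<comment> \<open>\<open>C1_curve\<close> quantifies over all charts; in \<open>c'\<close> the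
      velocity is the constant velocity of the segment mapped by the derivative of the
      transition.\<close>
    let ?D = "\<lambda>t. frechet_derivative (transition c c') (at (f t)) ?w"
    have "continuous_on {t \<in> {a..b}. \<gamma> t \<in> chart_dom c'} ?D"
    proof (rule continuous_on_compose2[OF continuous_transition_derivative[OF c c'] f_cont])
      show "f ` {t \<in> {a..b}. \<gamma> t \<in> chart_dom c'} \<subseteq> chart_map c ` (chart_dom c \<inter> chart_dom c')"
      proof (rule image_subsetI)
        fix t assume t: "t \<in> {t \<in> {a..b}. \<gamma> t \<in> chart_dom c'}"
        then have "f t = chart_map c (\<gamma> t)" "\<gamma> t \<in> chart_dom c" using \<gamma>_dom ab by auto
        then show "f t \<in> chart_map c ` (chart_dom c \<inter> chart_dom c')" using t by blast
      qed
    qed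
    moreover have "((\<lambda>s. chart_map c' (\<gamma> s)) has_vector_derivative ?D t) (at t within {a..b})"
      if "t \<in> {a..b}" "\<gamma> t \<in> chart_dom c'" for t
    proof -
      have "t \<in> {0..1}" "{a..b} \<subseteq> {0..1}" using that ab by auto
      then have "((\<lambda>s. chart_map c' (\<gamma> s)) has_vector_derivative
          frechet_derivative (transition c c') (at (chart_map c (\<gamma> t))) ?w) (at t within {a..b})"
        using that ab \<gamma>_dom(1) \<gamma>_M coord continuous_on_subset[OF cont]
        by (intro has_vector_derivative_change_chart c c') auto
      then show ?thesis using \<gamma>_dom(2)[OF \<open>t \<in> {0..1}\<close>] by simp
    qed
    ultimately show "\<exists>D. continuous_on {t \<in> {a..b}. \<gamma> t \<in> chart_dom c'} D \<and>
        (\<forall>t\<in>{a..b}. \<gamma> t \<in> chart_dom c' \<longrightarrow>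
          ((\<lambda>s. chart_map c' (\<gamma> s)) has_vector_derivative D t) (at t within {a..b}))"
      by (intro exI[of _ ?D]) auto
  qed
  have path: "piecewise_C1_path M A \<gamma>"
    unfolding piecewise_C1_path_def path_def path_image_def
    using cont \<gamma>_M C1 by (intro conjI exI[of _ "{}"]) auto
  have ends: "pathstart \<gamma> = x" "pathfinish \<gamma> = y"
    using xy c by (auto simp: pathstart_def pathfinish_def \<gamma>_def f_def)
  have speed: "curve_speed A g \<gamma> t \<le> u * norm ?w" if t: "t \<in> {0..1}" for t
  proof -
    have "curve_speed A g \<gamma> t = sqrt (g c (\<gamma> t) ?w ?w)"
      unfolding curve_speed_eq
      by (rule speed_within_chart[OF c]) (use cont \<gamma>_M t \<gamma>_dom coord[of t 0 1] in auto)
    then show ?thesis using K[OF f_K[OF t], of ?w] by (simp add: \<gamma>_def)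
  qed
  have "curve_length A g \<gamma> \<le> integral {0..1::real} (\<lambda>_. u * norm ?w)"
    unfolding curve_length_def
    by (rule integral_le[OF curve_speed_integrable[OF path]]) (use speed in auto)
  also have "\<dots> = u * norm ?w" by simp
  finally have "ereal (curve_length A g \<gamma>) \<le> ereal (u * norm ?w)" by simp
  then show ?thesis
    unfolding riemannian_dist_def using path ends by (intro INF_lower2[of \<gamma>]) auto
qed

end

section \<open>Velocity of orbits\<close>

locale flow_on_manifold = riemannian_manifold M A g
  for M :: "'a::t2_space set" and A :: "('a, 'e::euclidean_space) chart set"
    and g :: "('a, 'e) metric_tensor" +
  fixes \<Psi> :: "real \<Rightarrow> 'a \<Rightarrow> 'a"
  assumes flow: "differentiable_flow M A \<Psi>"
begin

lemma flow_in: "x \<in> M \<Longrightarrow> \<Psi> t x \<in> M"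
  using flow by (simp add: differentiable_flow_def)

lemma flow_0: "x \<in> M \<Longrightarrow> \<Psi> 0 x = x"
  using flow by (simp add: differentiable_flow_def)

lemma flow_plus: "x \<in> M \<Longrightarrow> \<Psi> (s + t) x = \<Psi> s (\<Psi> t x)"
  using flow by (simp add: differentiable_flow_def)

lemma flow_continuous: "continuous_on (UNIV \<times> M) (\<lambda>(t, x). \<Psi> t x)"
  using flow by (simp add: differentiable_flow_def)

lemma orbit_continuous: "x \<in> M \<Longrightarrow> continuous_on T (\<lambda>t. \<Psi> t x)"
  using continuous_on_compose2[OF flow_continuous, of T "\<lambda>t. (t, x)"]
  by (simp add: continuous_on_Pair image_subset_iff)

lemma time_map_continuous: "continuous_on M (\<Psi> t)"
  using continuous_on_compose2[OF flow_continuous, of M "\<lambda>x. (t, x)"]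
  by (simp add: continuous_on_Pair image_subset_iff)

lemma flow_coord_differentiable:
  assumes "c \<in> A" "c' \<in> A" "x \<in> chart_dom c" "\<Psi> t x \<in> chart_dom c'"
  shows "(\<lambda>(s, y). chart_map c' (\<Psi> s (chart_inv c y))) differentiable (at (t, chart_map c x))"
  using flow assms by (simp add: differentiable_flow_def)

lemma orbit_velocity:
  assumes "c \<in> A" "x \<in> chart_dom c"
  obtains w where "((\<lambda>s. chart_map c (\<Psi> s x)) has_vector_derivative w) (at 0)"
proof -
  let ?F = "\<lambda>(s, y). chart_map c (\<Psi> s (chart_inv c y))"
  have x: "x \<in> M" using assms chart_dom_subset by blast
  have "?F differentiable (at (0, chart_map c x))"
    using flow_0[OF x] assms by (intro flow_coord_differentiable) auto
  then obtain F' where F': "(?F has_derivative F') (at (0, chart_map c x))"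
    by (auto simp: differentiable_def)
  have "((\<lambda>s::real. (s, chart_map c x)) has_vector_derivative (1, 0)) (at 0)"
    unfolding has_vector_derivative_def by (auto intro!: derivative_eq_intros)
  then have "((?F \<circ> (\<lambda>s. (s, chart_map c x))) has_vector_derivative F' (1, 0)) (at 0)"
    using F' by (intro vector_derivative_diff_chain_within) (auto intro: has_derivative_at_withinI)
  then show ?thesis using that assms by (simp add: o_def)
qed

text \<open>Since \<open>\<Psi> (t + s) x = \<Psi> t (\<Psi> s x)\<close>, the velocity at time
  \<open>t\<close> is the image of the velocity at time 0 under a linear map, the derivative of the
  time \<open>t\<close> map.\<close>

lemma zero_velocity_transported:
  assumes c: "c \<in> A" "x \<in> chart_dom c" "\<Psi> t x \<in> chart_dom c"
    and 0: "((\<lambda>s. chart_map c (\<Psi> s x)) has_vector_derivative 0) (at 0)"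
  shows "((\<lambda>s. chart_map c (\<Psi> s x)) has_vector_derivative 0) (at t)"
proof -
  have x: "x \<in> M" using c chart_dom_subset by blast
  let ?F = "\<lambda>(s, y). chart_map c (\<Psi> s (chart_inv c y))"
  obtain F' where F': "(?F has_derivative F') (at (t, chart_map c x))"
    using flow_coord_differentiable[OF c(1,1,2,3)] by (auto simp: differentiable_def)
  interpret F': bounded_linear F' using F' by (rule has_derivative_bounded_linear)
  have "((\<lambda>s. (t, chart_map c (\<Psi> s x))) has_vector_derivative (0, 0)) (at 0)"
    using 0 unfolding has_vector_derivative_def by (auto intro!: derivative_eq_intros)
  moreover have "(?F has_derivative F') (at (t, chart_map c (\<Psi> 0 x)))"
    using F' flow_0[OF x] by simp
  ultimately have "((?F \<circ> (\<lambda>s. (t, chart_map c (\<Psi> s x)))) has_vector_derivative F' (0, 0)) (at 0)"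
    by (intro vector_derivative_diff_chain_within) (auto intro: has_derivative_at_withinI)
  moreover have "F' (0, 0) = 0" using F'.zero by (simp add: zero_prod_def)
  ultimately have *: "((\<lambda>s. chart_map c (\<Psi> t (chart_inv c (chart_map c (\<Psi> s x))))) has_vector_derivative 0) (at 0)"
    by (simp add: o_def)
  obtain e where e: "e > 0" "\<And>s. dist s 0 < e \<Longrightarrow> \<Psi> s x \<in> chart_dom c"
    using eventually_in_chart_dom[OF c(1) orbit_continuous[OF x, of UNIV], of 0] flow_in[OF x] flow_0[OF x] c(2)
    by auto
  have "((\<lambda>s. chart_map c (\<Psi> (t + s) x)) has_vector_derivative 0) (at 0)"
    using * e(1) UNIV_I
  proof (rule has_vector_derivative_transform_within)
    fix s :: real assume "dist s 0 < e"
    then show "chart_map c (\<Psi> t (chart_inv c (chart_map c (\<Psi> s x)))) = chart_map c (\<Psi> (t + s) x)"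
      using e(2) c(1) x by (simp add: flow_plus)
  qed
  then have "((\<lambda>s. chart_map c (\<Psi> (t + s) x)) has_derivative (\<lambda>h. 0)) (at 0)"
    by (simp add: has_vector_derivative_def)
  \<comment> \<open>Writing 0 as \<open>t - t\<close> prepares the composition with the translation
    by \<open>- t\<close>.\<close>
  then have "((\<lambda>s. chart_map c (\<Psi> (t + s) x)) has_derivative (\<lambda>h. 0)) (at (t - t))" by simp
  moreover have "((\<lambda>s. s - t) has_derivative (\<lambda>h. h)) (at t)" by (auto intro!: derivative_eq_intros)
  ultimately have "((\<lambda>s. chart_map c (\<Psi> (t + (s - t)) x)) has_derivative (\<lambda>h. 0)) (at t)"
    by (rule has_derivative_compose[rotated])
  then show ?thesis by (simp add: has_vector_derivative_def)
qed

text \<open>Differentiability alone gives no Lipschitz velocity field, so uniqueness for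
  differential equations is not invoked. Instead the zero velocity is transported along the orbit,
  which makes the orbit constant for short times, and the group law extends this to all
  times.\<close>

lemma fixed_point_if_zero_velocity:
  assumes c: "c \<in> A" "x \<in> chart_dom c"
    and 0: "((\<lambda>s. chart_map c (\<Psi> s x)) has_vector_derivative 0) (at 0)"
  shows "fixed_point \<Psi> x"
proof -
  have x: "x \<in> M" using c chart_dom_subset by blast
  obtain e where e: "e > 0" "\<And>s. dist s 0 < e \<Longrightarrow> \<Psi> s x \<in> chart_dom c"
    using eventually_in_chart_dom[OF c(1) orbit_continuous[OF x, of UNIV], of 0] flow_in[OF x] flow_0[OF x] c(2)
    by auto
  have "((\<lambda>s. chart_map c (\<Psi> s x)) has_vector_derivative 0) (at s within ball 0 e)" if "s \<in> ball 0 e" for s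
    using zero_velocity_transported[OF c e(2) 0] that
    by (auto intro: has_vector_derivative_at_within simp: dist_commute)
  then obtain z where z: "\<And>s. s \<in> ball 0 e \<Longrightarrow> chart_map c (\<Psi> s x) = z"
    using has_vector_derivative_zero_constant[of "ball 0 e" "\<lambda>s. chart_map c (\<Psi> s x)"] by auto
  have near: "\<Psi> s x = x" if "\<bar>s\<bar> < e" for s
  proof -
    have "chart_map c (\<Psi> s x) = chart_map c x"
      using z[of s] z[of 0] that e(1) flow_0[OF x] by simp
    then show ?thesis using chart_inv_map[OF c(1) e(2)[of s]] chart_inv_map[OF c] that by simp
  qed
  have "\<Psi> t x = x" for t
  proof -
    \<comment> \<open>Divides the time \<open>t\<close> into equal steps shorter than
      \<open>e\<close>.\<close>
    obtain n where "\<bar>t\<bar> / e < real n" using reals_Archimedean2 by blast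
    then have n: "\<bar>t\<bar> / e < real (Suc n)" by simp
    define s where "s = t / real (Suc n)"
    have "\<bar>s\<bar> < e" using n e(1) by (simp add: s_def abs_divide field_simps)
    have "\<Psi> (real k * s) x = x" for k
    proof (induction k)
      case (Suc k)
      have "\<Psi> (real (Suc k) * s) x = \<Psi> (s + real k * s) x" by (simp add: algebra_simps)
      then show ?case using Suc near[OF \<open>\<bar>s\<bar> < e\<close>] x by (simp add: flow_plus)
    qed (use flow_0[OF x] in simp)
    from this[of "Suc n"] show ?thesis by (simp add: s_def del: of_nat_Suc)
  qed
  then show ?thesis by (simp add: fixed_point_def)
qed

text \<open>The velocity \<open>w\<close> at time 0 is nonzero, and for small times the error of the
  linear approximation is at most half of its main term.\<close>

lemma coord_escape_rate:
  assumes c: "c \<in> A" "x \<in> chart_dom c" and x: "\<not> fixed_point \<Psi> x"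
  obtains a e where "a > 0" "e > 0"
    "\<And>t. \<bar>t\<bar> < e \<Longrightarrow> norm (chart_map c (\<Psi> t x) - chart_map c x) \<ge> a * \<bar>t\<bar>"
proof -
  obtain w where w: "((\<lambda>s. chart_map c (\<Psi> s x)) has_vector_derivative w) (at 0)"
    using orbit_velocity[OF c] by blast
  with x fixed_point_if_zero_velocity[OF c] have "w \<noteq> 0" by auto
  then have "norm w / 2 > 0" by simp
  with w obtain e where e: "e > 0" "\<And>t. norm (t - 0) < e \<Longrightarrow>
      norm (chart_map c (\<Psi> t x) - chart_map c (\<Psi> 0 x) - (t - 0) *\<^sub>R w) \<le> norm w / 2 * norm (t - 0)"
    unfolding has_vector_derivative_def has_derivative_at_alt by blast
  have "x \<in> M" using c chart_dom_subset by blast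
  show ?thesis
  proof (rule that[of "norm w / 2" e])
    fix t :: real assume "\<bar>t\<bar> < e"
    then have "norm (chart_map c (\<Psi> t x) - chart_map c x - t *\<^sub>R w) \<le> norm w / 2 * \<bar>t\<bar>"
      using e(2)[of t] flow_0[OF \<open>x \<in> M\<close>] by simp
    moreover have "norm (t *\<^sub>R w) \<le> norm (chart_map c (\<Psi> t x) - chart_map c x)
        + norm (chart_map c (\<Psi> t x) - chart_map c x - t *\<^sub>R w)"
      by (metis add_diff_cancel_left' diff_diff_eq2 norm_triangle_ineq4 add.commute diff_add_cancel)
    ultimately show "norm (chart_map c (\<Psi> t x) - chart_map c x) \<ge> norm w / 2 * \<bar>t\<bar>"
      by (simp add: mult.commute)
  qed (use \<open>norm w / 2 > 0\<close> e in auto)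
qed

end

section \<open>The inequalities\<close>

text \<open>The doubled ball leaves room \<open>\<rho>\<close> around each point of the smaller one,
  and on it the metric is comparable with the Euclidean norm by compactness.\<close>

lemma (in flow_on_manifold) AE_recurrence_rate_le_in_chart:
  assumes \<nu>: "borel_probability_on M \<nu>" "invariant_measure \<Psi> \<nu>"
    and c: "c \<in> A" and \<rho>: "\<rho> > 0" and z: "cball z (2 * \<rho>) \<subseteq> chart_map c ` chart_dom c"
    and d: "d = riemannian_dist M A g"
  shows "AE x in \<nu>. x \<in> chart_dom c \<and> chart_map c x \<in> ball z \<rho> \<longrightarrow> \<not> fixed_point \<Psi> x \<longrightarrow>
    lower_recurrence_rate M d \<Psi> x \<le> lower_pointwise_dim M d \<nu> x - 1 \<and>
    upper_recurrence_rate M d \<Psi> x \<le> upper_pointwise_dim M d \<nu> x - 1"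
proof -
  interpret prob_space \<nu> using \<nu>(1) by (simp add: borel_probability_on_def)
  have space: "space \<nu> = M" and sets: "sets \<nu> = sets (restrict_space borel M)"
    using \<nu>(1) by (auto simp: borel_probability_on_def)
  define V where "V = {p \<in> chart_dom c. chart_map c p \<in> ball z \<rho>}"
  have openin_sets: "S \<in> sets \<nu>" if "openin (top_of_set M) S" for S
  proof -
    from that obtain W where "open W" "S = M \<inter> W" by (auto simp: openin_open)
    then show ?thesis unfolding sets sets_restrict_space by auto
  qed
  obtain l u where l: "l > 0" and u: "u > 0"
    and lK: "\<And>y w. y \<in> cball z (2 * \<rho>) \<Longrightarrow> l * norm w \<le> sqrt (g c (chart_inv c y) w w)"
    and uK: "\<And>y w. y \<in> cball z (2 * \<rho>) \<Longrightarrow> sqrt (g c (chart_inv c y) w w) \<le> u * norm w"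
    using metric_norm_equiv[OF c compact_cball z] by metis
  \<comment> \<open>The upper metric bound \<open>u\<close> controls distances by coordinates, the
    lower bound \<open>l\<close> controls coordinates by distances, and \<open>l * \<rho>\<close> is
    the length needed to leave a ball of coordinate radius \<open>\<rho>\<close>.\<close>
  interpret flow_in_chart \<nu> d \<Psi> "chart_dom c" V "chart_map c" u "1 / l" "l * \<rho>"
  proof
    show "\<Psi> t \<in> measurable \<nu> \<nu>" for t
    proof -
      have "\<Psi> t \<in> borel_measurable (restrict_space borel M)"
        by (rule borel_measurable_continuous_on_restrict[OF time_map_continuous])
      then have "\<Psi> t \<in> measurable (restrict_space borel M) (restrict_space borel M)"
        by (intro measurable_restrict_space2) (auto simp: space_restrict_space flow_in)
      then show ?thesis using measurable_cong_sets[OF sets sets] by blast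
    qed
    show "prob (\<Psi> t -` E \<inter> space \<nu>) = prob E" if "E \<in> events" for t E
      using \<nu>(2) that by (simp add: invariant_measure_def measure_def)
    show "\<Psi> 0 x = x" if "x \<in> space \<nu>" for x using that flow_0 space by simp
    show "\<Psi> (s + t) x = \<Psi> s (\<Psi> t x)" if "x \<in> space \<nu>" for s t x using that flow_plus space by simp
    show "chart_dom c \<in> events" using openin_sets chart_dom_openin[OF c] .
    show "V \<in> events" unfolding V_def using openin_sets openin_chart_ball[OF c] .
    show "V \<subseteq> chart_dom c" by (auto simp: V_def)
    show "chart_map c \<in> borel_measurable (restrict_space \<nu> (chart_dom c))"
    proof -
      have "chart_map c \<in> borel_measurable (restrict_space borel (chart_dom c))"
        by (rule borel_measurable_continuous_on_restrict[OF continuous_chart_map[OF c]])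
      moreover have "sets (restrict_space \<nu> (chart_dom c)) = sets (restrict_space borel (chart_dom c))"
      proof -
        have "sets (restrict_space \<nu> (chart_dom c)) = sets (restrict_space (restrict_space borel M) (chart_dom c))"
          by (rule sets_restrict_space_cong[OF sets])
        also have "\<dots> = sets (restrict_space borel (M \<inter> chart_dom c))"
          by (rule sets_restrict_restrict_space)
        also have "M \<inter> chart_dom c = chart_dom c" using chart_dom_subset[OF c] by blast
        finally show ?thesis .
      qed
      ultimately show ?thesis using measurable_cong_sets by blast
    qed
    show "bounded (chart_map c ` V)"
      by (rule bounded_subset[OF bounded_ball[of z \<rho>]]) (auto simp: V_def)
    show "d x y \<le> ereal (u * norm (chart_map c y - chart_map c x))" if "x \<in> V" "y \<in> V" for x y
      unfolding d
    proof (rule riemannian_dist_le[OF c u uK _ _ _ z])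
      have "closed_segment (chart_map c x) (chart_map c y) \<subseteq> ball z \<rho>"
        using that by (intro closed_segment_subset convex_ball) (auto simp: V_def)
      then show "closed_segment (chart_map c x) (chart_map c y) \<subseteq> cball z (2 * \<rho>)"
        using \<rho> by force
    qed (use that in \<open>auto simp: V_def\<close>)
    show "y \<in> chart_dom c \<and> norm (chart_map c y - chart_map c x) < 1 / l * r"
      if "x \<in> V" "y \<in> space \<nu>" "d x y < ereal r" "r \<le> l * \<rho>" for x y r
    proof -
      have "cball (chart_map c x) \<rho> \<subseteq> cball z (2 * \<rho>)"
        using that(1) by (simp add: cball_subset_cball_iff V_def dist_commute)
      with that have "y \<in> chart_dom c \<and> norm (chart_map c y - chart_map c x) < r / l"
        unfolding d by (intro riemannian_dist_less_imp[OF c l \<rho> lK _ _ z]) (auto simp: V_def)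
      then show ?thesis by simp
    qed
    show "u > 0" "1 / l > 0" "l * \<rho> > 0" using l u \<rho> by auto
  qed
  have ex: "\<exists>m\<ge>1. x \<in> escaping m" if x: "x \<in> V" "\<not> fixed_point \<Psi> x" for x
  proof -
    obtain a e where a: "a > 0" and e: "e > 0"
      and esc: "\<And>t. \<bar>t\<bar> < e \<Longrightarrow> norm (chart_map c (\<Psi> t x) - chart_map c x) \<ge> a * \<bar>t\<bar>"
      using coord_escape_rate[OF c _ x(2)] x(1) by (auto simp: V_def)
    \<comment> \<open>Two demands on \<open>m\<close>: it exceeds \<open>1 / (l * a)\<close>, so
      that at time \<open>m / 2 ^ k\<close> the displacement is at least
      \<open>1 / l / 2 ^ k\<close>, and \<open>m / 2 ^ m < e\<close>, so that all these times with
      \<open>k \<ge> m\<close> are in the range of the linear estimate.\<close>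
    have "(\<lambda>n. real n * (1 / 2) ^ n) \<longlonglongrightarrow> 0"
      by (rule powser_times_n_limit_0) simp
    then have "\<forall>\<^sub>F n in sequentially. real n * (1 / 2) ^ n < e"
      using e by (rule order_tendstoD)
    moreover have "\<forall>\<^sub>F n in sequentially. n \<ge> nat \<lceil>1 / (l * a)\<rceil> + 1"
      by (rule eventually_ge_at_top)
    ultimately have "\<forall>\<^sub>F n in sequentially. real n * (1 / 2) ^ n < e \<and> n \<ge> nat \<lceil>1 / (l * a)\<rceil> + 1"
      by (rule eventually_conj)
    then obtain m where m: "real m * (1 / 2) ^ m < e" "m \<ge> nat \<lceil>1 / (l * a)\<rceil> + 1"
      using eventually_happens'[OF sequentially_bot] by blast
    have "1 / (l * a) \<le> real m" using m(2) by linarith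
    then have ma: "1 / l \<le> a * real m" using a l by (simp add: field_simps)
    have "norm (chart_map c (\<Psi> (m / 2 ^ k) x) - chart_map c x) \<ge> 1 / l / 2 ^ k" if "k \<ge> m" for k
    proof -
      have "real m / 2 ^ k \<le> real m / 2 ^ m"
        using that by (intro divide_left_mono power_increasing) auto
      also have "\<dots> < e" using m(1) by (simp add: power_one_over)
      finally have "a * \<bar>real m / 2 ^ k\<bar> \<le> norm (chart_map c (\<Psi> (m / 2 ^ k) x) - chart_map c x)"
        by (intro esc) simp
      moreover have "1 / l / 2 ^ k \<le> a * real m / 2 ^ k"
        using ma by (intro divide_right_mono) auto
      ultimately show ?thesis by simp
    qed
    then show ?thesis using m(2) x(1) by (auto simp: escaping_def intro!: exI[of _ m])
  qed
  \<comment> \<open>The sets \<open>escaping m\<close> cover the non-fixed points of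
    \<open>V\<close>, and countably many null sets are discarded.\<close>
  have "AE x in \<nu>. \<forall>m. m \<ge> 1 \<longrightarrow> x \<in> escaping m \<longrightarrow>
    lower_recurrence_rate M d \<Psi> x \<le> lower_pointwise_dim M d \<nu> x - 1 \<and>
    upper_recurrence_rate M d \<Psi> x \<le> upper_pointwise_dim M d \<nu> x - 1"
    unfolding AE_all_countable using AE_recurrence_rate_le space by auto
  then show ?thesis
    by (rule AE_mp) (use ex in \<open>auto simp: V_def intro!: AE_I2\<close>)
qed

theorem theorem1p2:
  fixes M :: "'a::t2_space set"
    and A :: "('a, 'e::euclidean_space) chart set"
    and g :: "('a, 'e) metric_tensor"
    and d :: "'a \<Rightarrow> 'a \<Rightarrow> ereal"
    and \<Psi> :: "real \<Rightarrow> 'a \<Rightarrow> 'a"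
    and \<nu> :: "'a measure"
  assumes "compact_riemannian_manifold M A g"
    and "d = riemannian_dist M A g"
    and "differentiable_flow M A \<Psi>"
    and "borel_probability_on M \<nu>"
    and "invariant_measure \<Psi> \<nu>"
  shows "AE x in \<nu>. \<not> fixed_point \<Psi> x \<longrightarrow>
           lower_recurrence_rate M d \<Psi> x \<le> lower_pointwise_dim M d \<nu> x - 1 \<and>
           upper_recurrence_rate M d \<Psi> x \<le> upper_pointwise_dim M d \<nu> x - 1"
proof -
  interpret flow_on_manifold M A g \<Psi>
    using assms(1,3) by unfold_locales (auto simp: compact_riemannian_manifold_def)
  define W :: "('a, 'e) chart \<times> 'e \<times> real \<Rightarrow> 'a set"
    where "W = (\<lambda>(c, z, r). {p \<in> chart_dom c. chart_map c p \<in> ball z r})"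
  \<comment> \<open>Indices of the coordinate balls to which the local result applies. By
    compactness finitely many of them cover \<open>M\<close>, so the exceptional sets unite to a
    null set.\<close>
  define I where "I = {(c, z, r). c \<in> A \<and> r > 0 \<and> cball z (2 * r) \<subseteq> chart_map c ` chart_dom c}"
  have cover: "M \<subseteq> \<Union> (W ` I)"
  proof
    fix x assume "x \<in> M"
    then obtain c where c: "c \<in> A" "x \<in> chart_dom c" using ex_chart by blast
    then obtain r where r: "r > 0" "cball (chart_map c x) r \<subseteq> chart_map c ` chart_dom c"
      using open_contains_cball open_chart_image[OF c(1)] by blast
    then have "(c, chart_map c x, r / 2) \<in> I" using c by (simp add: I_def)
    moreover have "x \<in> W (c, chart_map c x, r / 2)" using c r by (simp add: W_def)
    ultimately show "x \<in> \<Union> (W ` I)" by blast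
  qed
  have "openin (top_of_set M) (W i)" if "i \<in> I" for i
    using that openin_chart_ball by (auto simp: I_def W_def)
  moreover have "compact M" using assms(1) by (simp add: compact_riemannian_manifold_def)
  ultimately obtain F where F: "F \<subseteq> W ` I" "finite F" "M \<subseteq> \<Union> F"
    using cover unfolding compact_eq_openin_cover by (metis (no_types, lifting) imageE)
  then obtain J where J: "J \<subseteq> I" "finite J" "F = W ` J" by (meson finite_subset_image)
  have "AE x in \<nu>. \<forall>i\<in>J. x \<in> W i \<longrightarrow> \<not> fixed_point \<Psi> x \<longrightarrow>
      lower_recurrence_rate M d \<Psi> x \<le> lower_pointwise_dim M d \<nu> x - 1 \<and>
      upper_recurrence_rate M d \<Psi> x \<le> upper_pointwise_dim M d \<nu> x - 1"
  proof (rule AE_finite_allI[OF J(2)])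
    fix i assume "i \<in> J"
    then obtain c z r where i: "i = (c, z, r)" "c \<in> A" "r > 0" "cball z (2 * r) \<subseteq> chart_map c ` chart_dom c"
      using J(1) by (auto simp: I_def)
    show "AE x in \<nu>. x \<in> W i \<longrightarrow> \<not> fixed_point \<Psi> x \<longrightarrow>
      lower_recurrence_rate M d \<Psi> x \<le> lower_pointwise_dim M d \<nu> x - 1 \<and>
      upper_recurrence_rate M d \<Psi> x \<le> upper_pointwise_dim M d \<nu> x - 1"
      using AE_recurrence_rate_le_in_chart[OF assms(4,5) i(2-4) assms(2)]
      by (simp add: i(1) W_def)
  qed
  then show ?thesis
  proof (rule AE_mp, intro AE_I2 impI)
    fix x assume x: "x \<in> space \<nu>" "\<not> fixed_point \<Psi> x" and *: "\<forall>i\<in>J. x \<in> W i \<longrightarrow> \<not> fixed_point \<Psi> x \<longrightarrow>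
      lower_recurrence_rate M d \<Psi> x \<le> lower_pointwise_dim M d \<nu> x - 1 \<and>
      upper_recurrence_rate M d \<Psi> x \<le> upper_pointwise_dim M d \<nu> x - 1"
    have "x \<in> M" using x(1) assms(4) by (simp add: borel_probability_on_def)
    then obtain i where "i \<in> J" "x \<in> W i" using F(3) J(3) by auto
    then show "lower_recurrence_rate M d \<Psi> x \<le> lower_pointwise_dim M d \<nu> x - 1 \<and>
      upper_recurrence_rate M d \<Psi> x \<le> upper_pointwise_dim M d \<nu> x - 1"
      using * x(2) by blast
  qed
qed

end
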